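(* Let $E$ be a locally finite graph without sinks, with associated Deaconu-Renault system $(X,\sigma)$. Then the metric entropy of $E$ and the topological entropy of $E$ coincide, i.e. $h_d(\sigma)=h(\sigma)$, where $h_d(\sigma)$ is computed with respect to the metric $d=d_X$.
   Context: $\mathbb N=\{1,2,\dots\}$. A graph is a quadruple $E=(E^0,E^1,r,s)$ with countable sets $E^0$ of vertices and $E^1$ of edges and maps $r,s:E^1\to E^0$ (range and source). It has no sinks if $s^{-1}(v)\neq\emptyset$ for all $v$; it is row-finite if $|s^{-1}(v)|<\infty$ for all $v\in E^0$, and locally finite if it is row-finite and $|r^{-1}(v)|<\infty$ for all $v\in E^0$. A path of length $n$ is a sequence $e_1\dots e_n$ of edges with $s(e_{i+1})=r(e_i)$; infinite paths are defined similarly. The associated Deaconu-Renault system is $(X,\sigma)$ where $X$ is the set of infinite paths in $E$ with the topology generated by cylinder sets (sets of infinite paths with a given finite initial segment), and $\sigma:X\to X$ is the shift $\sigma(x_1x_2\dots)=x_2x_3\dots$, $Dom(\sigma)=X$. Metric $d_X$. Let $\mathfrak p$ be the countable set consisting of all finite paths of length $\geq1$ together with all nonempty finite subsets of $E^0$ (regarded as paths of length $0$). A finite path $\beta$ of length $\ge 1$ is an initial segment of $x\in X$ if $x=\beta\gamma$ for some infinite path $\gamma$; a finite set $A\subseteq E^0$ is an initial segment of $x$ if $s(x):=s(x_1)\in A$. Fix an enumeration $\mathfrak p=\{p_1,p_2,\dots\}$ and set $d_X(x,x)=0$ and, for $x\ne y$, $d_X(x,y)=2^{-i}$ where $i$ is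 the smallest index such that $p_i$ is an initial segment of exactly one of $x,y$. This metric induces the topology of $X$, and the metric entropy does not depend on the enumeration. Metric entropy (here $Dom(\sigma^n)=X$ for all $n$, and $d=d_X$). $d_n(x,y)=\max_{0\le i\le n-1}d(\sigma^i(x),\sigma^i(y))$; for $K\subseteq X$ compact, $sep(n,\varepsilon,\sigma,K)$ is the largest cardinality of a set $A\subseteq K$ with $d_n(x,y)>\varepsilon$ for all distinct $x,y\in A$; $h_d(\sigma,K)=\lim_{\varepsilon\to0}\limsup_{n\to\infty}\frac1n\log sep(n,\varepsilon,\sigma,K)$ (with $\log 0:=0$); $h_d(\sigma)=\sup_Kh_d(\sigma,K)$ over compact $K\subseteq X$. Topological entropy. For families $\alpha,\beta$ of subsets of $X$ let $\alpha\vee\beta=\{A\cap B:A\in\alpha,B\in\beta\}$ and $\sigma^{-i}(\alpha)=\{\sigma^{-i}(A):A\in\alpha\}$. For compact $K\subseteq X$, an open cover $\alpha$ of $K$ (a family of open subsets of $X$ whose union contains $K$) and $n\in\mathbb N$, let $\alpha_n=\alpha\vee\sigma^{-1}(\alpha)\vee\dots\vee\sigma^{-n}(\alpha)$, a cover of $K_n=K\cap\sigma^{-1}(K)\cap\dots\cap\sigma^{-n}(K)$. $N(\alpha_n,K_n)$ is the smallest cardinality of a subfamily of $\alpha_n$ covering $K_n$ (with $N=1$ if $K_n=\emptyset$); $h(\alpha,\sigma,K)=\lim_{n\to\infty}\frac1n\log N(\alpha_n,K_n)$ (this limit exists); $h(\sigma,K)=\sup_\alpha h(\alpha,\sigma,K)$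 over open covers $\alpha$ of $K$; $h(\sigma)=\sup_Kh(\sigma,K)$ over compact $K\subseteq X$. *)

theory Defs
  imports
    "HOL-Analysis.Analysis"
    "HOL-Library.Omega_Words_Fun"
    "Graph_Theory.Arc_Walk"
begin

section \<open>Entropy of a map on a topological space\<close>

definition bowen_dist :: "('a \<Rightarrow> 'a \<Rightarrow> real) \<Rightarrow> ('a \<Rightarrow> 'a) \<Rightarrow> nat \<Rightarrow> 'a \<Rightarrow> 'a \<Rightarrow> real" where
  "bowen_dist d f n x y = Max ((\<lambda>i. d ((f ^^ i) x) ((f ^^ i) y)) ` {..<n})"

text \<open>For \<open>f\<close> continuous, \<open>d\<close> inducing the topology and \<open>K\<close> compact, the cardinalities in
  question are bounded, so that the supremum in \<^typ>\<open>nat\<close> is a maximum.\<close>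

definition sep :: "('a \<Rightarrow> 'a \<Rightarrow> real) \<Rightarrow> ('a \<Rightarrow> 'a) \<Rightarrow> 'a set \<Rightarrow> nat \<Rightarrow> real \<Rightarrow> nat" where
  "sep d f K n \<epsilon> =
    Sup (card ` {A. A \<subseteq> K \<and> finite A \<and> (\<forall>x\<in>A. \<forall>y\<in>A. x \<noteq> y \<longrightarrow> bowen_dist d f n x y > \<epsilon>)})"

text \<open>The convention \<open>log 0 = 0\<close>, needed for \<open>K = {}\<close>, is that of the library: \<open>ln 0 = 0\<close>.\<close>

definition metric_entropy_on :: "('a \<Rightarrow> 'a \<Rightarrow> real) \<Rightarrow> ('a \<Rightarrow> 'a) \<Rightarrow> 'a set \<Rightarrow> ereal" where
  "metric_entropy_on d f K =
    Lim (at_right 0) (\<lambda>\<epsilon>. limsup (\<lambda>n. ereal (1 / real n * ln (real (sep d f K n \<epsilon>)))))"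

definition metric_entropy ::
  "'a topology \<Rightarrow> ('a \<Rightarrow> 'a \<Rightarrow> real) \<Rightarrow> ('a \<Rightarrow> 'a) \<Rightarrow> ereal" where
  "metric_entropy X d f = (SUP K \<in> {K. compactin X K}. metric_entropy_on d f K)"

definition family_join :: "'a set set \<Rightarrow> 'a set set \<Rightarrow> 'a set set" where
  "family_join \<alpha> \<beta> = {A \<inter> B |A B. A \<in> \<alpha> \<and> B \<in> \<beta>}"

definition pullback :: "'a topology \<Rightarrow> ('a \<Rightarrow> 'a) \<Rightarrow> nat \<Rightarrow> 'a set \<Rightarrow> 'a set" where
  "pullback X f i A = {x \<in> topspace X. (f ^^ i) x \<in> A}"

primrec iterated_join ::
  "'a topology \<Rightarrow> ('a \<Rightarrow> 'a) \<Rightarrow> 'a set set \<Rightarrow> nat \<Rightarrow> 'a set set" where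
  "iterated_join X f \<alpha> 0 = \<alpha>"
| "iterated_join X f \<alpha> (Suc n) =
    family_join (iterated_join X f \<alpha> n) (pullback X f (Suc n) ` \<alpha>)"

definition staying_set :: "'a topology \<Rightarrow> ('a \<Rightarrow> 'a) \<Rightarrow> 'a set \<Rightarrow> nat \<Rightarrow> 'a set" where
  "staying_set X f K n = (\<Inter>i\<le>n. pullback X f i K)"

text \<open>The definition is used for open covers of compact sets, where a finite subcover exists.\<close>

definition min_subcover :: "'a set set \<Rightarrow> 'a set \<Rightarrow> nat" where
  "min_subcover \<alpha> K =
    (if K = {} then 1 else Inf (card ` {\<beta>. \<beta> \<subseteq> \<alpha> \<and> finite \<beta> \<and> K \<subseteq> \<Union>\<beta>}))"

definition open_cover_of :: "'a topology \<Rightarrow> 'a set \<Rightarrow> 'a set set \<Rightarrow> bool" where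
  "open_cover_of X K \<alpha> \<longleftrightarrow> (\<forall>U\<in>\<alpha>. openin X U) \<and> K \<subseteq> \<Union>\<alpha>"

definition cover_entropy ::
  "'a topology \<Rightarrow> ('a \<Rightarrow> 'a) \<Rightarrow> 'a set set \<Rightarrow> 'a set \<Rightarrow> ereal" where
  "cover_entropy X f \<alpha> K =
    lim (\<lambda>n. ereal (1 / real n *
      ln (real (min_subcover (iterated_join X f \<alpha> n) (staying_set X f K n)))))"

definition top_entropy_on :: "'a topology \<Rightarrow> ('a \<Rightarrow> 'a) \<Rightarrow> 'a set \<Rightarrow> ereal" where
  "top_entropy_on X f K = (SUP \<alpha> \<in> {\<alpha>. open_cover_of X K \<alpha>}. cover_entropy X f \<alpha> K)"

definition top_entropy :: "'a topology \<Rightarrow> ('a \<Rightarrow> 'a) \<Rightarrow> ereal" where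
  "top_entropy X f = (SUP K \<in> {K. compactin X K}. top_entropy_on X f K)"


section \<open>Graphs and their Deaconu-Renault systems\<close>

text \<open>Source and range of an edge are its \<^const>\<open>tail\<close> and \<^const>\<open>head\<close>.\<close>

definition countable_graph :: "('v, 'e) pre_digraph \<Rightarrow> bool" where
  "countable_graph E \<longleftrightarrow> wf_digraph E \<and> countable (verts E) \<and> countable (arcs E)"

definition no_sinks :: "('v, 'e) pre_digraph \<Rightarrow> bool" where
  "no_sinks E \<longleftrightarrow> (\<forall>v \<in> verts E. out_arcs E v \<noteq> {})"

definition row_finite :: "('v, 'e) pre_digraph \<Rightarrow> bool" where
  "row_finite E \<longleftrightarrow> (\<forall>v \<in> verts E. finite (out_arcs E v))"

definition locally_finite_graph :: "('v, 'e) pre_digraph \<Rightarrow> bool" where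
  "locally_finite_graph E \<longleftrightarrow> row_finite E \<and> (\<forall>v \<in> verts E. finite (in_arcs E v))"

definition infinite_paths :: "('v, 'e) pre_digraph \<Rightarrow> 'e word set" where
  "infinite_paths E = {x. \<forall>n. x n \<in> arcs E \<and> tail E (x (Suc n)) = head E (x n)}"

definition finite_paths :: "('v, 'e) pre_digraph \<Rightarrow> 'e list set" where
  "finite_paths E = {\<beta>. \<beta> \<noteq> [] \<and> (\<exists>u v. pre_digraph.awalk E u \<beta> v)}"

definition cylinder :: "('v, 'e) pre_digraph \<Rightarrow> 'e list \<Rightarrow> 'e word set" where
  "cylinder E \<beta> = {x \<in> infinite_paths E. \<exists>\<gamma> \<in> infinite_paths E. x = \<beta> \<frown> \<gamma>}"

definition path_space :: "('v, 'e) pre_digraph \<Rightarrow> 'e word topology" where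
  "path_space E = topology_generated_by (cylinder E ` finite_paths E)"

definition shift :: "'e word \<Rightarrow> 'e word" where
  "shift x = (\<lambda>n. x (Suc n))"

datatype ('v, 'e) segment = Path_segment "'e list" | Vertex_segment "'v set"

definition segments :: "('v, 'e) pre_digraph \<Rightarrow> ('v, 'e) segment set" where
  "segments E =
    Path_segment ` finite_paths E \<union>
    Vertex_segment ` {A. A \<noteq> {} \<and> finite A \<and> A \<subseteq> verts E}"

primrec initial_segment ::
  "('v, 'e) pre_digraph \<Rightarrow> ('v, 'e) segment \<Rightarrow> 'e word \<Rightarrow> bool" where
  "initial_segment E (Path_segment \<beta>) x \<longleftrightarrow> (\<exists>\<gamma> \<in> infinite_paths E. x = \<beta> \<frown> \<gamma>)"
| "initial_segment E (Vertex_segment A) x \<longleftrightarrow> tail E (x 0) \<in> A"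

text \<open>Indices start at 1; \<open>p 0\<close> is irrelevant. The set of segments is empty only if the graph has
  no vertices, and then there is nothing to enumerate. Otherwise, in the absence of sinks, it is
  infinite. Repetitions are allowed.\<close>

definition enumerates_segments ::
  "('v, 'e) pre_digraph \<Rightarrow> (nat \<Rightarrow> ('v, 'e) segment) \<Rightarrow> bool" where
  "enumerates_segments E p \<longleftrightarrow> (segments E \<noteq> {} \<longrightarrow> p ` {1..} = segments E)"

definition path_dist ::
  "('v, 'e) pre_digraph \<Rightarrow> (nat \<Rightarrow> ('v, 'e) segment) \<Rightarrow> 'e word \<Rightarrow> 'e word \<Rightarrow> real" where
  "path_dist E p x y =
    (if x = y then 0
     else (1 / 2) ^ (LEAST i. i \<ge> 1 \<and> initial_segment E (p i) x \<noteq> initial_segment E (p i) y))"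

end

theory Submission
  imports Defs "HOL-Real_Asymp.Real_Asymp"
begin

text \<open>
  The topological entropy dominates the growth of closed paths: the paths of length \<open>n\<close> from an edge
  \<open>e\<close> back to \<open>e\<close>, if there are \<open>c\<close> of them, can be concatenated at will and generate a compact
  shift-invariant set of entropy at least \<open>(log c)/n\<close>. The path metric at scale \<open>\<epsilon>\<close>, on the other
  hand, sees only a finite set \<open>F\<close> of edges, so that separated sets are bounded by the number of
  words that the paths trace on \<open>F\<close>, all other edges being blanked out. Distinct words from \<open>e\<close> back
  to \<open>e\<close> are traced by distinct closed paths, even if these leave \<open>F\<close> in between; hence there are at
  most \<open>exp (h n)\<close> of them, \<open>h\<close> being the topological entropy. Adding the edges to \<open>F\<close> one by
  one, and cutting each path at its first and last passage through the new edge, one gets at most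
  \<open>(n + 2)\<^sup>d exp (h n)\<close> words of length \<open>n\<close>, and the metric entropy is at most \<open>h\<close>. The converse
  inequality is the usual Lebesgue number argument.
\<close>

section \<open>Existence of the entropy of a cover\<close>

lemma subadditive_iterate_le:
  fixes b :: "nat \<Rightarrow> real"
  assumes "\<And>m n. m \<ge> 1 \<Longrightarrow> n \<ge> 1 \<Longrightarrow> b (m + n) \<le> b m + b n" and "m \<ge> 1" "r \<ge> 1"
  shows "b (q * m + r) \<le> q * b m + b r"
proof (induction q)
  case (Suc q)
  have "b (Suc q * m + r) = b (m + (q * m + r))"
    by (simp add: algebra_simps)
  also have "\<dots> \<le> b m + b (q * m + r)"
    using assms by (intro assms(1)) auto
  also have "\<dots> \<le> Suc q * b m + b r"
    using Suc by (simp add: algebra_simps)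
  finally show ?case .
qed simp

text \<open>The limit is the infimum of \<open>b n / n\<close> over positive n. Given m with
  \<open>b m / m\<close> close to it, any n is a multiple of m plus a remainder, and subadditivity
  bounds \<open>b n\<close> by that multiple of \<open>b m\<close> plus a constant independent of
  n.\<close>

lemma fekete:
  fixes b :: "nat \<Rightarrow> real"
  assumes sub: "\<And>m n. m \<ge> 1 \<Longrightarrow> n \<ge> 1 \<Longrightarrow> b (m + n) \<le> b m + b n"
    and nonneg: "\<And>n. b n \<ge> 0"
  obtains L where "L \<ge> 0" "(\<lambda>n. b n / n) \<longlonglongrightarrow> L"
proof
  define L where "L = (INF n\<in>{1..}. b n / n)"
  have bdd: "bdd_below ((\<lambda>n. b n / real n) ` {1..})"
    using nonneg by (intro bdd_belowI[of _ 0]) auto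
  show "L \<ge> 0"
    unfolding L_def using nonneg by (intro cINF_greatest) auto
  have lower: "L \<le> b n / n" if "n \<ge> 1" for n
    unfolding L_def using that by (intro cINF_lower bdd) auto
  show "(\<lambda>n. b n / n) \<longlonglongrightarrow> L"
  proof (rule order_tendstoI)
    fix a assume "a < L"
    then show "\<forall>\<^sub>F n in sequentially. a < b n / n"
      using lower by (intro eventually_sequentiallyI[of 1]) (meson less_le_trans)
  next
    fix a assume "L < a"
    then obtain m where m: "m \<ge> 1" "b m / m < a"
      unfolding L_def using cINF_less_iff[OF _ bdd, of a] by auto
    define C where "C = (\<Sum>r=1..m. b r)"
    have bound: "b n / n \<le> b m / m + C / n" if "n \<ge> 1" for n
    proof -
      \<comment> \<open>The remainder is taken in 1..m instead of 0..m-1, because subadditivity is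
        assumed for positive arguments only.\<close>
      define q r where "q = (n - 1) div m" and "r = (n - 1) mod m + 1"
      have n: "n = q * m + r" and r: "r \<ge> 1" "r \<le> m"
        using that m by (auto simp: q_def r_def Suc_leI)
      have "b n \<le> q * b m + b r"
        unfolding n by (rule subadditive_iterate_le) (use sub m r in auto)
      also have "b r \<le> C"
        unfolding C_def using r nonneg by (intro member_le_sum) auto
      also have "q * b m \<le> (n / m) * b m"
        using nonneg n m by (intro mult_right_mono) (simp_all add: field_simps flip: of_nat_mult)
      finally show ?thesis
        using that m by (simp add: field_simps)
    qed
    have "(\<lambda>n. b m / m + C / real n) \<longlonglongrightarrow> b m / m"
      by real_asymp
    then have "\<forall>\<^sub>F n in sequentially. b m / m + C / real n < a"
      using m by (intro order_tendstoD) auto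
    then show "\<forall>\<^sub>F n in sequentially. b n / n < a"
      using eventually_ge_at_top[of 1]
      by eventually_elim (use bound in force)
  qed
qed

text \<open>A member of the join is given by an itinerary \<open>g\<close>, a choice of a member of
  \<alpha> for each time up to n. The hypothesis secures the case n = 0, where the join is \<alpha>
  itself and its members are not cut down to the space.\<close>

lemma iterated_join_eq:
  assumes "\<Union>\<alpha> \<subseteq> topspace X"
  shows "iterated_join X f \<alpha> n =
    {{x \<in> topspace X. \<forall>i\<le>n. (f ^^ i) x \<in> g i} | g. \<forall>i\<le>n. g i \<in> \<alpha>}"
proof (induction n)
  case 0
  have eq: "{x \<in> topspace X. \<forall>i\<le>0. (f ^^ i) x \<in> g i} = g 0" if "g 0 \<in> \<alpha>" for g
    using assms that by auto
  show ?case
  proof (intro equalityI subsetI)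
    fix U assume "U \<in> iterated_join X f \<alpha> 0"
    then have "U \<in> \<alpha>"
      by simp
    with eq[of "\<lambda>_. U"] show "U \<in> {{x \<in> topspace X. \<forall>i\<le>0. (f ^^ i) x \<in> g i} | g. \<forall>i\<le>0. g i \<in> \<alpha>}"
      by (intro CollectI exI[of _ "\<lambda>_. U"] conjI) (rule sym, auto)
  next
    fix U assume "U \<in> {{x \<in> topspace X. \<forall>i\<le>0. (f ^^ i) x \<in> g i} | g. \<forall>i\<le>0. g i \<in> \<alpha>}"
    then show "U \<in> iterated_join X f \<alpha> 0"
      using eq by auto
  qed
next
  case (Suc n)
  show ?case
  proof (intro equalityI subsetI)
    fix U assume "U \<in> iterated_join X f \<alpha> (Suc n)"
    then obtain g A where g: "\<forall>i\<le>n. g i \<in> \<alpha>" "A \<in> \<alpha>"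
      and U: "U = {x \<in> topspace X. \<forall>i\<le>n. (f ^^ i) x \<in> g i} \<inter> pullback X f (Suc n) A"
      unfolding iterated_join.simps Suc family_join_def by auto
    have "U = {x \<in> topspace X. \<forall>i\<le>Suc n. (f ^^ i) x \<in> (g(Suc n := A)) i}"
      unfolding U pullback_def by (auto simp: le_Suc_eq)
    moreover have "\<forall>i\<le>Suc n. (g(Suc n := A)) i \<in> \<alpha>"
      using g by (auto simp: le_Suc_eq)
    ultimately show "U \<in> {{x \<in> topspace X. \<forall>i\<le>Suc n. (f ^^ i) x \<in> g i} | g. \<forall>i\<le>Suc n. g i \<in> \<alpha>}"
      by (intro CollectI exI[of _ "g(Suc n := A)"] conjI)
  next
    fix U assume "U \<in> {{x \<in> topspace X. \<forall>i\<le>Suc n. (f ^^ i) x \<in> g i} | g. \<forall>i\<le>Suc n. g i \<in> \<alpha>}"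
    then obtain g where g: "\<forall>i\<le>Suc n. g i \<in> \<alpha>"
      and U: "U = {x \<in> topspace X. \<forall>i\<le>Suc n. (f ^^ i) x \<in> g i}"
      by (elim CollectE exE conjE) blast
    have "U = {x \<in> topspace X. \<forall>i\<le>n. (f ^^ i) x \<in> g i} \<inter> pullback X f (Suc n) (g (Suc n))"
      unfolding U pullback_def by (auto simp: le_Suc_eq)
    moreover have "{x \<in> topspace X. \<forall>i\<le>n. (f ^^ i) x \<in> g i} \<in> iterated_join X f \<alpha> n"
      unfolding Suc using g by (intro CollectI exI[of _ g]) simp
    moreover have "pullback X f (Suc n) (g (Suc n)) \<in> pullback X f (Suc n) ` \<alpha>"
      using g by simp
    ultimately show "U \<in> iterated_join X f \<alpha> (Suc n)"
      unfolding iterated_join.simps family_join_def by blast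
  qed
qed

section \<open>Minimal subcovers of iterated joins\<close>

lemma staying_set_eq: "staying_set X f K n = {x \<in> topspace X. \<forall>i\<le>n. (f ^^ i) x \<in> K}"
  unfolding staying_set_def pullback_def by auto

lemma finite_iterated_join: "finite \<alpha> \<Longrightarrow> finite (iterated_join X f \<alpha> n)"
proof (induction n)
  case (Suc n)
  have "family_join A B = (\<lambda>(a, b). a \<inter> b) ` (A \<times> B)" for A B :: "'a set set"
    by (auto simp: family_join_def)
  then show ?case
    using Suc by simp
qed simp

lemma iterated_join_mono: "\<alpha> \<subseteq> \<beta> \<Longrightarrow> iterated_join X f \<alpha> n \<subseteq> iterated_join X f \<beta> n"
proof (induction n)
  case (Suc n)
  then show ?case
    unfolding iterated_join.simps family_join_def by blast
qed simp

lemma min_subcover_le: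
  assumes "\<beta> \<subseteq> \<alpha>" "finite \<beta>" "K \<subseteq> \<Union>\<beta>" "K \<noteq> {}"
  shows "min_subcover \<alpha> K \<le> card \<beta>"
  unfolding min_subcover_def using assms by (auto intro!: cInf_lower)

lemma min_subcover_attained:
  assumes "\<beta> \<subseteq> \<alpha>" "finite \<beta>" "K \<subseteq> \<Union>\<beta>" "K \<noteq> {}"
  obtains \<gamma> where "\<gamma> \<subseteq> \<alpha>" "finite \<gamma>" "K \<subseteq> \<Union>\<gamma>" "card \<gamma> = min_subcover \<alpha> K"
proof -
  have "Inf (card ` {\<beta>. \<beta> \<subseteq> \<alpha> \<and> finite \<beta> \<and> K \<subseteq> \<Union>\<beta>}) \<in> card ` {\<beta>. \<beta> \<subseteq> \<alpha> \<and> finite \<beta> \<and> K \<subseteq> \<Union>\<beta>}"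
    using assms by (intro Inf_nat_def1) auto
  then obtain \<gamma> where "\<gamma> \<subseteq> \<alpha>" "finite \<gamma>" "K \<subseteq> \<Union>\<gamma>" "card \<gamma> = Inf (card ` {\<beta>. \<beta> \<subseteq> \<alpha> \<and> finite \<beta> \<and> K \<subseteq> \<Union>\<beta>})"
    by (smt (verit, best) imageE mem_Collect_eq)
  with that assms(4) show thesis
    unfolding min_subcover_def by metis
qed

text \<open>Compactness is applied to K alone: the itineraries through a finite subcover of K form a
  finite family that covers the staying set. This keeps the infimum in \<open>min_subcover\<close>
  from ranging over the empty set.\<close>

lemma finite_subcover_iterated_join:
  assumes K: "compactin X K" and \<alpha>: "open_cover_of X K \<alpha>"
  obtains \<beta> where "\<beta> \<subseteq> iterated_join X f \<alpha> n" "finite \<beta>" "staying_set X f K n \<subseteq> \<Union>\<beta>"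
proof -
  obtain \<alpha>' where \<alpha>': "\<alpha>' \<subseteq> \<alpha>" "finite \<alpha>'" "K \<subseteq> \<Union>\<alpha>'"
    using K \<alpha> unfolding compactin_def open_cover_of_def by metis
  have "\<Union>\<alpha>' \<subseteq> topspace X"
    using \<alpha>' \<alpha> openin_subset unfolding open_cover_of_def by blast
  note eq = iterated_join_eq[of \<alpha>' X f n, OF this]
  show thesis
  proof
    show "iterated_join X f \<alpha>' n \<subseteq> iterated_join X f \<alpha> n" "finite (iterated_join X f \<alpha>' n)"
      using \<alpha>' iterated_join_mono finite_iterated_join by metis+
    show "staying_set X f K n \<subseteq> \<Union>(iterated_join X f \<alpha>' n)"
    proof
      fix x assume x: "x \<in> staying_set X f K n"
      then have "\<forall>i\<in>{..n}. \<exists>A. A \<in> \<alpha>' \<and> (f ^^ i) x \<in> A"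
        using \<alpha>'(3) unfolding staying_set_eq by auto
      then obtain g where "\<forall>i\<in>{..n}. g i \<in> \<alpha>' \<and> (f ^^ i) x \<in> g i"
        by metis
      then show "x \<in> \<Union>(iterated_join X f \<alpha>' n)"
        unfolding eq using x by (auto simp: staying_set_eq)
    qed
  qed
qed

lemma min_subcover_iterated_join_ge_1:
  assumes "compactin X K" "open_cover_of X K \<alpha>"
  shows "min_subcover (iterated_join X f \<alpha> n) (staying_set X f K n) \<ge> 1"
proof (cases "staying_set X f K n = {}")
  case False
  from finite_subcover_iterated_join[OF assms, of f n] obtain \<beta>
    where "\<beta> \<subseteq> iterated_join X f \<alpha> n" "finite \<beta>" "staying_set X f K n \<subseteq> \<Union>\<beta>" .
  from min_subcover_attained[OF this False] obtain \<gamma>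
    where "finite \<gamma>" "staying_set X f K n \<subseteq> \<Union>\<gamma>"
      "card \<gamma> = min_subcover (iterated_join X f \<alpha> n) (staying_set X f K n)"
    by metis
  moreover from this False have "\<gamma> \<noteq> {}"
    by auto
  ultimately show ?thesis
    by (metis One_nat_def Suc_leI card_gt_0_iff)
qed (simp add: min_subcover_def)

text \<open>An orbit segment of m + n + 2 points is cut into its first m + 1 points and the n + 1
  points starting at \<open>(f ^^ Suc m) x\<close>. Optimal covers for the two pieces, the second
  one pulled back, are intersected pairwise.\<close>

lemma min_subcover_submultiplicative:
  assumes f: "f \<in> topspace X \<rightarrow> topspace X" and cpt: "compactin X K" and \<alpha>: "open_cover_of X K \<alpha>"
  shows "min_subcover (iterated_join X f \<alpha> (Suc (m + n))) (staying_set X f K (Suc (m + n))) \<le>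
    min_subcover (iterated_join X f \<alpha> m) (staying_set X f K m) *
    min_subcover (iterated_join X f \<alpha> n) (staying_set X f K n)"
proof (cases "staying_set X f K (Suc (m + n)) = {}")
  \<comment> \<open>An empty staying set has count 1 by convention, and both factors are at least
    1.\<close>
  case True
  then show ?thesis
    using mult_le_mono[OF min_subcover_iterated_join_ge_1[OF cpt \<alpha>, of f m]
        min_subcover_iterated_join_ge_1[OF cpt \<alpha>, of f n]]
    by (simp add: min_subcover_def)
next
  case False
  have fi: "(f ^^ i) x \<in> topspace X" if "x \<in> topspace X" for i x
    using that f by (induction i) auto
  have "\<Union>\<alpha> \<subseteq> topspace X"
    using \<alpha> openin_subset unfolding open_cover_of_def by blast
  note eq = iterated_join_eq[of \<alpha> X f, OF this]
  have st: "x \<in> staying_set X f K m \<and> (f ^^ Suc m) x \<in> staying_set X f K n"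
    if "x \<in> staying_set X f K (Suc (m + n))" for x
  proof -
    from that have x: "x \<in> topspace X" "\<And>i. i \<le> Suc (m + n) \<Longrightarrow> (f ^^ i) x \<in> K"
      by (auto simp: staying_set_eq)
    have "(f ^^ i) ((f ^^ Suc m) x) = (f ^^ (i + Suc m)) x" for i
      by (metis comp_apply funpow_add)
    with x fi[OF x(1), of "Suc m"] show ?thesis
      by (auto simp: staying_set_eq simp del: funpow.simps)
  qed
  then have ne: "staying_set X f K m \<noteq> {}" "staying_set X f K n \<noteq> {}"
    using False by blast+
  from finite_subcover_iterated_join[OF cpt \<alpha>, of f m] min_subcover_attained[OF _ _ _ ne(1)]
  obtain \<beta> where \<beta>: "\<beta> \<subseteq> iterated_join X f \<alpha> m" "finite \<beta>" "staying_set X f K m \<subseteq> \<Union>\<beta>"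
    "card \<beta> = min_subcover (iterated_join X f \<alpha> m) (staying_set X f K m)"
    by metis
  from finite_subcover_iterated_join[OF cpt \<alpha>, of f n] min_subcover_attained[OF _ _ _ ne(2)]
  obtain \<gamma> where \<gamma>: "\<gamma> \<subseteq> iterated_join X f \<alpha> n" "finite \<gamma>" "staying_set X f K n \<subseteq> \<Union>\<gamma>"
    "card \<gamma> = min_subcover (iterated_join X f \<alpha> n) (staying_set X f K n)"
    by metis
  define \<delta> where "\<delta> = (\<lambda>(U, V). U \<inter> pullback X f (Suc m) V) ` (\<beta> \<times> \<gamma>)"
  have "min_subcover (iterated_join X f \<alpha> (Suc (m + n))) (staying_set X f K (Suc (m + n))) \<le> card \<delta>"
  proof (rule min_subcover_le[OF _ _ _ False])
    show "finite \<delta>"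
      unfolding \<delta>_def using \<beta> \<gamma> by simp
    show "staying_set X f K (Suc (m + n)) \<subseteq> \<Union>\<delta>"
    proof
      fix x assume x: "x \<in> staying_set X f K (Suc (m + n))"
      with st \<beta>(3) \<gamma>(3) obtain U V where "U \<in> \<beta>" "V \<in> \<gamma>" "x \<in> U" "(f ^^ Suc m) x \<in> V"
        by blast
      with x show "x \<in> \<Union>\<delta>"
        unfolding \<delta>_def pullback_def by (force simp: staying_set_eq simp del: funpow.simps)
    qed
    show "\<delta> \<subseteq> iterated_join X f \<alpha> (Suc (m + n))"
    proof
      fix W assume "W \<in> \<delta>"
      then obtain U V where "U \<in> \<beta>" "V \<in> \<gamma>" and W0: "W = U \<inter> pullback X f (Suc m) V"
        unfolding \<delta>_def by auto
      with \<beta>(1) \<gamma>(1) have "U \<in> iterated_join X f \<alpha> m" "V \<in> iterated_join X f \<alpha> n"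
        by auto
      then obtain g g' where g: "\<forall>i\<le>m. g i \<in> \<alpha>" "\<forall>i\<le>n. g' i \<in> \<alpha>"
        and U: "U = {x \<in> topspace X. \<forall>i\<le>m. (f ^^ i) x \<in> g i}"
        and V: "V = {x \<in> topspace X. \<forall>i\<le>n. (f ^^ i) x \<in> g' i}"
        unfolding eq by blast
      \<comment> \<open>The itinerary \<open>g\<close> followed by \<open>g'\<close>, which takes
        over at time m + 1.\<close>
      define h where "h i = (if i \<le> m then g i else g' (i - Suc m))" for i
      have split: "(\<forall>i\<le>Suc (m + n). P i) \<longleftrightarrow> (\<forall>i\<le>m. P i) \<and> (\<forall>i\<le>n. P (i + Suc m))" for P
      proof (intro iffI conjI allI impI)
        fix i assume *: "(\<forall>i\<le>m. P i) \<and> (\<forall>i\<le>n. P (i + Suc m))" "i \<le> Suc (m + n)"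
        show "P i"
        proof (cases "i \<le> m")
          case False
          then have "i = (i - Suc m) + Suc m" "i - Suc m \<le> n"
            using * by auto
          then show ?thesis
            using *(1) by metis
        qed (use * in auto)
      qed auto
      have comp: "(f ^^ i) ((f ^^ Suc m) x) = (f ^^ (i + Suc m)) x" for i x
        by (metis comp_apply funpow_add)
      have h: "h (i + Suc m) = g' i" "i \<le> m \<Longrightarrow> h i = g i" for i
        by (simp_all add: h_def)
      have "x \<in> W \<longleftrightarrow> x \<in> topspace X \<and> (\<forall>i\<le>Suc (m + n). (f ^^ i) x \<in> h i)" for x
        unfolding split W0 U V pullback_def h comp[symmetric]
        using fi[of x "Suc m"] h(2) by blast
      then have "W = {x \<in> topspace X. \<forall>i\<le>Suc (m + n). (f ^^ i) x \<in> h i}"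
        by blast
      moreover have "\<forall>i\<le>Suc (m + n). h i \<in> \<alpha>"
        unfolding split h using g h(2) by simp
      ultimately show "W \<in> iterated_join X f \<alpha> (Suc (m + n))"
        unfolding eq by blast
    qed
  qed
  also have "card \<delta> \<le> card \<beta> * card \<gamma>"
    unfolding \<delta>_def using card_image_le[of "\<beta> \<times> \<gamma>"] \<beta> \<gamma> by (simp add: card_cartesian_product)
  finally show ?thesis
    using \<beta> \<gamma> by simp
qed

definition cover_log :: "'a topology \<Rightarrow> ('a \<Rightarrow> 'a) \<Rightarrow> 'a set set \<Rightarrow> 'a set \<Rightarrow> nat \<Rightarrow> real" where
  "cover_log X f \<alpha> K k =
    ln (min_subcover (iterated_join X f \<alpha> (k - 1)) (staying_set X f K (k - 1)))"

text \<open>The cover \<open>\<alpha>\<^sub>n\<close> looks at \<open>n + 1\<close> points of an orbit, so that subadditivity holds for the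
  sequence shifted by one.\<close>

lemma cover_entropy_limit:
  assumes f: "f \<in> topspace X \<rightarrow> topspace X" and cpt: "compactin X K" and \<alpha>: "open_cover_of X K \<alpha>"
  obtains L :: real where "L \<ge> 0" "(\<lambda>k. cover_log X f \<alpha> K k / k) \<longlonglongrightarrow> L" "cover_entropy X f \<alpha> K = L"
proof -
  note ge = min_subcover_iterated_join_ge_1[OF cpt \<alpha>, of f]
  have "cover_log X f \<alpha> K (m + n) \<le> cover_log X f \<alpha> K m + cover_log X f \<alpha> K n"
    if "m \<ge> 1" "n \<ge> 1" for m n
  proof -
    let ?N = "\<lambda>k. min_subcover (iterated_join X f \<alpha> k) (staying_set X f K k)"
    have eq: "m + n - 1 = Suc ((m - 1) + (n - 1))"
      using that by simp
    have "?N (m + n - 1) \<le> ?N (m - 1) * ?N (n - 1)"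
      unfolding eq by (rule min_subcover_submultiplicative[OF assms])
    then have "ln (real (?N (m + n - 1))) \<le> ln (real (?N (m - 1)) * real (?N (n - 1)))"
      using ge[of "m + n - 1"] ge[of "m - 1"] ge[of "n - 1"]
      by (subst ln_le_cancel_iff) (auto simp flip: of_nat_mult)
    also have "\<dots> = ln (real (?N (m - 1))) + ln (real (?N (n - 1)))"
      using ge[of "m - 1"] ge[of "n - 1"] by (intro ln_mult_pos) auto
    finally show ?thesis
      unfolding cover_log_def .
  qed
  moreover have "cover_log X f \<alpha> K n \<ge> 0" for n
    unfolding cover_log_def using ge[of "n - 1"] by simp
  ultimately obtain L where L: "L \<ge> 0" "(\<lambda>k. cover_log X f \<alpha> K k / k) \<longlonglongrightarrow> L"
    using fekete[of "cover_log X f \<alpha> K"] by metis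
  \<comment> \<open>The definition of the entropy divides by n, while n + 1 points are counted; the
    ratio of the two tends to 1.\<close>
  have "(\<lambda>n. cover_log X f \<alpha> K (Suc n) / Suc n * (Suc n / n)) \<longlonglongrightarrow> L * 1"
    by (intro tendsto_mult LIMSEQ_Suc[OF L(2)]) real_asymp
  then have "(\<lambda>n. 1 / n * ln (min_subcover (iterated_join X f \<alpha> n) (staying_set X f K n))) \<longlonglongrightarrow> L"
    by (simp add: cover_log_def)
  then have "cover_entropy X f \<alpha> K = L"
    unfolding cover_entropy_def by (intro limI) simp
  with L that show thesis
    by blast
qed

text \<open>The empty compact set with the empty cover is a witness, so this holds even for an empty
  space. It rules out the value minus infinity when the entropy is later taken to be a real
  number.\<close>

lemma top_entropy_nonneg:
  assumes "f \<in> topspace X \<rightarrow> topspace X"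
  shows "top_entropy X f \<ge> 0"
proof -
  have \<alpha>: "open_cover_of X {} {}"
    by (simp add: open_cover_of_def)
  obtain L where "L \<ge> 0" "cover_entropy X f {} {} = ereal L"
    using cover_entropy_limit[OF assms compactin_empty \<alpha>] by metis
  then have "0 \<le> cover_entropy X f {} {}"
    by simp
  also have "\<dots> \<le> top_entropy_on X f {}"
    unfolding top_entropy_on_def using \<alpha> by (intro SUP_upper) simp
  also have "\<dots> \<le> top_entropy X f"
    unfolding top_entropy_def by (intro SUP_upper) simp
  finally show ?thesis .
qed

section \<open>Separated sets\<close>

definition separated :: "('a \<Rightarrow> 'a \<Rightarrow> real) \<Rightarrow> ('a \<Rightarrow> 'a) \<Rightarrow> nat \<Rightarrow> real \<Rightarrow> 'a set \<Rightarrow> bool" where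
  "separated d f n \<epsilon> A \<longleftrightarrow> (\<forall>x\<in>A. \<forall>y\<in>A. x \<noteq> y \<longrightarrow> bowen_dist d f n x y > \<epsilon>)"

lemma sep_eq: "sep d f K n \<epsilon> = Sup (card ` {A. A \<subseteq> K \<and> finite A \<and> separated d f n \<epsilon> A})"
  unfolding sep_def separated_def ..

text \<open>A supremum in \<open>nat\<close> is informative for bounded sets only, so statements
  about \<open>sep\<close> are accompanied by an explicit bound.\<close>

definition sep_bound ::
  "('a \<Rightarrow> 'a \<Rightarrow> real) \<Rightarrow> ('a \<Rightarrow> 'a) \<Rightarrow> 'a set \<Rightarrow> nat \<Rightarrow> real \<Rightarrow> nat \<Rightarrow> bool" where
  "sep_bound d f K n \<epsilon> M \<longleftrightarrow> (\<forall>A. A \<subseteq> K \<and> finite A \<and> separated d f n \<epsilon> A \<longrightarrow> card A \<le> M)"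

lemma card_separated_le_sep:
  assumes "sep_bound d f K n \<epsilon> M" "A \<subseteq> K" "finite A" "separated d f n \<epsilon> A"
  shows "card A \<le> sep d f K n \<epsilon>"
  unfolding sep_eq using assms by (intro cSup_upper bdd_aboveI[of _ M]) (auto simp: sep_bound_def)

lemma sep_le:
  assumes "sep_bound d f K n \<epsilon> M"
  shows "sep d f K n \<epsilon> \<le> M"
proof -
  have "{} \<in> {A. A \<subseteq> K \<and> finite A \<and> separated d f n \<epsilon> A}"
    by (simp add: separated_def)
  then show ?thesis
    unfolding sep_eq using assms by (intro cSup_least) (auto simp: sep_bound_def)
qed

lemma sep_antimono:
  assumes "sep_bound d f K n \<epsilon> M" "\<epsilon> \<le> \<epsilon>'"
  shows "sep d f K n \<epsilon>' \<le> sep d f K n \<epsilon>"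
proof (rule sep_le)
  have "separated d f n \<epsilon> A" if "separated d f n \<epsilon>' A" for A
    using that assms(2) by (force simp: separated_def)
  then show "sep_bound d f K n \<epsilon>' (sep d f K n \<epsilon>)"
    using card_separated_le_sep[OF assms(1)] by (simp add: sep_bound_def)
qed

text \<open>A separated set of largest cardinality is spanning, since a point far from all its
  members could be added to it. The alternative \<open>x = y\<close> is listed separately because
  \<open>d\<close> is not assumed to vanish on the diagonal.\<close>

lemma separated_spanning:
  assumes "sep_bound d f K n \<epsilon> M"
    and sym: "\<And>x y. d x y = d y x"
  obtains A where "A \<subseteq> K" "finite A" "separated d f n \<epsilon> A"
    "\<And>x. x \<in> K \<Longrightarrow> \<exists>y\<in>A. x = y \<or> bowen_dist d f n x y \<le> \<epsilon>"
proof -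
  let ?P = "\<lambda>A. A \<subseteq> K \<and> finite A \<and> separated d f n \<epsilon> A"
  have "?P {}"
    by (simp add: separated_def)
  then obtain A where A: "?P A" and max: "\<And>B. ?P B \<Longrightarrow> card B \<le> card A"
    using ex_has_greatest_nat[of ?P "{}" card "Suc M"] assms(1) by (metis le_imp_less_Suc sep_bound_def)
  have "\<exists>y\<in>A. x = y \<or> bowen_dist d f n x y \<le> \<epsilon>" if "x \<in> K" for x
  proof (rule ccontr)
    assume *: "\<not> ?thesis"
    have "bowen_dist d f n y x = bowen_dist d f n x y" for y
      unfolding bowen_dist_def using sym by simp
    then have "separated d f n \<epsilon> (insert x A)"
      using * A unfolding separated_def not_le[symmetric] by (metis insert_iff)
    then have "?P (insert x A)"
      using A that by simp
    moreover have "card (insert x A) > card A"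
      using A * by (subst card_insert_disjoint) auto
    ultimately show False
      using max[of "insert x A"] by simp
  qed
  then show thesis
    using A by (intro that[of A]) auto
qed

definition sep_growth :: "('a \<Rightarrow> 'a \<Rightarrow> real) \<Rightarrow> ('a \<Rightarrow> 'a) \<Rightarrow> 'a set \<Rightarrow> real \<Rightarrow> ereal" where
  "sep_growth d f K \<epsilon> = limsup (\<lambda>n. ereal (1 / real n * ln (real (sep d f K n \<epsilon>))))"

text \<open>For \<open>n = 0\<close> no bound is available, \<^const>\<open>bowen_dist\<close> being a maximum over the empty set.\<close>

lemma sep_growth_antimono:
  assumes bdd: "\<And>n. n \<ge> 1 \<Longrightarrow> \<exists>M. sep_bound d f K n \<epsilon> M"
    and "\<epsilon> \<le> \<epsilon>'"
  shows "sep_growth d f K \<epsilon>' \<le> sep_growth d f K \<epsilon>"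
  unfolding sep_growth_def
proof (intro Limsup_mono eventually_sequentiallyI[of 1])
  fix n :: nat assume n: "n \<ge> 1"
  from bdd[OF n] have "sep d f K n \<epsilon>' \<le> sep d f K n \<epsilon>"
    using assms(2) sep_antimono by metis
  \<comment> \<open>By the convention \<open>ln 0 = 0\<close> the logarithm is monotone on all
    natural numbers, including 0.\<close>
  then have "ln (real (sep d f K n \<epsilon>')) \<le> ln (real (sep d f K n \<epsilon>))"
    by (cases "sep d f K n \<epsilon>' = 0"; cases "sep d f K n \<epsilon> = 0") auto
  then show "ereal (1 / real n * ln (real (sep d f K n \<epsilon>'))) \<le> ereal (1 / real n * ln (real (sep d f K n \<epsilon>)))"
    by (simp add: divide_right_mono)
qed

text \<open>The growth rate increases as \<epsilon> decreases, so it converges to its supremum.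
  Convergence has to be shown before \<open>Lim\<close> can be evaluated.\<close>

lemma metric_entropy_on_eq_SUP:
  assumes bdd: "\<And>n \<epsilon>. n \<ge> 1 \<Longrightarrow> \<epsilon> > 0 \<Longrightarrow>
    \<exists>M. sep_bound d f K n \<epsilon> M"
  shows "metric_entropy_on d f K = (SUP \<epsilon>\<in>{0<..}. sep_growth d f K \<epsilon>)"
proof -
  have "(sep_growth d f K \<longlongrightarrow> (SUP \<epsilon>\<in>{0<..}. sep_growth d f K \<epsilon>)) (at_right 0)"
  proof (rule order_tendstoI)
    fix a assume "a < (SUP \<epsilon>\<in>{0<..}. sep_growth d f K \<epsilon>)"
    then obtain \<epsilon>' where \<epsilon>': "\<epsilon>' > 0" "a < sep_growth d f K \<epsilon>'"
      by (auto simp: less_SUP_iff)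
    show "\<forall>\<^sub>F \<epsilon> in at_right 0. a < sep_growth d f K \<epsilon>"
      unfolding eventually_at_right_field
    proof (intro exI conjI allI impI)
      fix \<epsilon> :: real assume "0 < \<epsilon>" "\<epsilon> < \<epsilon>'"
      then have "sep_growth d f K \<epsilon>' \<le> sep_growth d f K \<epsilon>"
        by (intro sep_growth_antimono bdd) auto
      with \<epsilon>' show "a < sep_growth d f K \<epsilon>"
        by simp
    qed (fact \<epsilon>')
  next
    fix a assume a: "(SUP \<epsilon>\<in>{0<..}. sep_growth d f K \<epsilon>) < a"
    have "sep_growth d f K \<epsilon> < a" if "\<epsilon> > 0" for \<epsilon>
      using that by (intro le_less_trans[OF SUP_upper a]) simp
    then show "\<forall>\<^sub>F \<epsilon> in at_right 0. sep_growth d f K \<epsilon> < a"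
      using eventually_at_right_less[of "0 :: real"] by (auto elim: eventually_mono)
  qed
  then show ?thesis
    unfolding metric_entropy_on_def sep_growth_def
    by (intro tendsto_Lim trivial_limit_at_right_real)
qed

text \<open>Assign to each point of K a member of \<alpha> that contains its whole \<epsilon>-ball.
  The itinerary obtained from the orbit of y then contains the Bowen ball around y, and the Bowen
  balls around a maximal separated set cover.\<close>

lemma cover_entropy_le_sep_growth:
  assumes f: "f \<in> topspace X \<rightarrow> topspace X" and cpt: "compactin X K" and \<alpha>: "open_cover_of X K \<alpha>"
    and bdd: "\<And>n. n \<ge> 1 \<Longrightarrow> \<exists>M. sep_bound d f K n \<epsilon> M"
    and sym: "\<And>x y. d x y = d y x"
    and lebesgue: "\<And>x. x \<in> K \<Longrightarrow> \<exists>U\<in>\<alpha>. x \<in> U \<and> (\<forall>y\<in>topspace X. d y x \<le> \<epsilon> \<longrightarrow> y \<in> U)"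
  shows "cover_entropy X f \<alpha> K \<le> sep_growth d f K \<epsilon>"
proof -
  have fi: "(f ^^ i) x \<in> topspace X" if "x \<in> topspace X" for i x
    using that f by (induction i) auto
  have "\<Union>\<alpha> \<subseteq> topspace X"
    using \<alpha> openin_subset unfolding open_cover_of_def by blast
  note eq = iterated_join_eq[of \<alpha> X f, OF this]
  obtain c where c: "\<And>x. x \<in> K \<Longrightarrow> c x \<in> \<alpha> \<and> x \<in> c x \<and> (\<forall>y\<in>topspace X. d y x \<le> \<epsilon> \<longrightarrow> y \<in> c x)"
    using lebesgue by metis
  have le: "cover_log X f \<alpha> K k \<le> ln (sep d f K k \<epsilon>)" if k: "k \<ge> 1" for k
  proof -
    obtain n where n: "k = Suc n"
      using k by (cases k) auto
    let ?S = "staying_set X f K n"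
    have SK: "?S \<subseteq> K"
      unfolding staying_set_eq by (auto dest: spec[of _ 0])
    obtain M where M: "sep_bound d f K k \<epsilon> M"
      using bdd[OF k] by blast
    show ?thesis
    proof (cases "?S = {}")
      \<comment> \<open>The cover count is 1, with logarithm 0, and the logarithm on the right is
        nonnegative even for the count 0.\<close>
      case True
      then show ?thesis
        unfolding cover_log_def n by (cases "sep d f K k \<epsilon> = 0") (auto simp: min_subcover_def n)
    next
      case False
      \<comment> \<open>The separated set is chosen inside the staying set and not just inside K:
        the iterates of its points must lie in K, where \<open>c\<close> is controlled.\<close>
      have M': "sep_bound d f ?S k \<epsilon> M"
        using M SK unfolding sep_bound_def by blast
      obtain A where A: "A \<subseteq> ?S" "finite A" "separated d f k \<epsilon> A"
        and span: "\<And>x. x \<in> ?S \<Longrightarrow> \<exists>y\<in>A. x = y \<or> bowen_dist d f k x y \<le> \<epsilon>"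
        using separated_spanning[OF M' sym] by metis
      define U where "U y = {x \<in> topspace X. \<forall>i\<le>n. (f ^^ i) x \<in> c ((f ^^ i) y)}" for y
      have "min_subcover (iterated_join X f \<alpha> n) ?S \<le> card (U ` A)"
      proof (rule min_subcover_le[OF _ _ _ False])
        show "finite (U ` A)"
          using A by simp
        have "U y \<in> iterated_join X f \<alpha> n" if "y \<in> A" for y
        proof -
          have "\<forall>i\<le>n. c ((f ^^ i) y) \<in> \<alpha>"
            using that A(1) c unfolding staying_set_eq by blast
          then show ?thesis
            unfolding eq U_def by (auto intro!: exI[of _ "\<lambda>i. c ((f ^^ i) y)"])
        qed
        then show "U ` A \<subseteq> iterated_join X f \<alpha> n"
          by auto
        show "?S \<subseteq> \<Union>(U ` A)"
        proof
          fix x assume x: "x \<in> ?S"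
          then obtain y where y: "y \<in> A" "x = y \<or> bowen_dist d f k x y \<le> \<epsilon>"
            using span by blast
          have "(f ^^ i) x \<in> c ((f ^^ i) y)" if i: "i \<le> n" for i
          proof -
            have yK: "(f ^^ i) y \<in> K" and xX: "(f ^^ i) x \<in> topspace X"
              using y(1) A(1) i x fi by (auto simp: staying_set_eq)
            from y(2) show ?thesis
            proof
              assume "x = y"
              with c yK show ?thesis by blast
            next
              assume "bowen_dist d f k x y \<le> \<epsilon>"
              moreover have "d ((f ^^ i) x) ((f ^^ i) y) \<le> bowen_dist d f k x y"
                unfolding bowen_dist_def using i n by (intro Max_ge) auto
              ultimately show ?thesis
                using c[OF yK] xX by auto
            qed
          qed
          then have "x \<in> U y"
            using x by (simp add: U_def staying_set_eq)
          with y(1) show "x \<in> \<Union>(U ` A)"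
            by blast
        qed
      qed
      also have "\<dots> \<le> card A"
        using A(2) by (rule card_image_le)
      also have "\<dots> \<le> sep d f K k \<epsilon>"
        by (rule card_separated_le_sep[OF M]) (use A SK in auto)
      finally show ?thesis
        unfolding cover_log_def using min_subcover_iterated_join_ge_1[OF cpt \<alpha>, of f n]
        by (simp add: n)
    qed
  qed
  obtain L where L: "(\<lambda>k. cover_log X f \<alpha> K k / k) \<longlonglongrightarrow> L" "cover_entropy X f \<alpha> K = ereal L"
    using cover_entropy_limit[OF f cpt \<alpha>] by metis
  have "ereal L = limsup (\<lambda>k. ereal (cover_log X f \<alpha> K k / k))"
    using L(1) by (intro lim_imp_Limsup[symmetric]) auto
  also have "\<dots> \<le> sep_growth d f K \<epsilon>"
    unfolding sep_growth_def
  proof (intro Limsup_mono eventually_sequentiallyI[of 1])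
    fix k :: nat assume "k \<ge> 1"
    with le show "ereal (cover_log X f \<alpha> K k / k) \<le> ereal (1 / real k * ln (real (sep d f K k \<epsilon>)))"
      by (simp add: divide_right_mono)
  qed
  finally show ?thesis
    using L(2) by simp
qed

section \<open>The path space\<close>

lemma shift_funpow: "(shift ^^ k) x = (\<lambda>n. x (n + k))"
proof (induction k)
  case (Suc k)
  have "(shift ^^ Suc k) x = shift (\<lambda>n. x (n + k))"
    by (simp add: Suc)
  also have "\<dots> = (\<lambda>n. x (n + Suc k))"
    by (simp add: shift_def)
  finally show ?case .
qed simp

lemma infinite_paths_suffix:
  assumes "x \<in> infinite_paths E"
  shows "(\<lambda>n. x (n + k)) \<in> infinite_paths E"
proof -
  have "x (n + k) \<in> arcs E \<and> tail E (x (Suc (n + k))) = head E (x (n + k))" for n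
    using assms unfolding infinite_paths_def by blast
  then show ?thesis
    by (simp add: infinite_paths_def)
qed

lemma map_upt_eq_iff: "map x [0..<length \<beta>] = \<beta> \<longleftrightarrow> (\<forall>k<length \<beta>. x k = \<beta> ! k)"
  by (simp add: list_eq_iff_nth_eq[of "map x [0..<length \<beta>]" \<beta>])

lemma initial_segment_path_iff:
  assumes "x \<in> infinite_paths E"
  shows "initial_segment E (Path_segment \<beta>) x \<longleftrightarrow> map x [0..<length \<beta>] = \<beta>"
proof
  assume "map x [0..<length \<beta>] = \<beta>"
  then have "x = \<beta> \<frown> (\<lambda>n. x (n + length \<beta>))"
    by (auto simp: conc_def map_upt_eq_iff)
  then show "initial_segment E (Path_segment \<beta>) x"
    using infinite_paths_suffix[OF assms] by (metis initial_segment.simps(1))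
next
  assume "initial_segment E (Path_segment \<beta>) x"
  then obtain \<gamma> where "x = \<beta> \<frown> \<gamma>"
    by auto
  then show "map x [0..<length \<beta>] = \<beta>"
    by (simp add: map_upt_eq_iff)
qed

lemma cylinder_eq: "cylinder E \<beta> = {x \<in> infinite_paths E. map x [0..<length \<beta>] = \<beta>}"
proof -
  have "cylinder E \<beta> = {x \<in> infinite_paths E. initial_segment E (Path_segment \<beta>) x}"
    by (simp add: cylinder_def)
  also have "\<dots> = {x \<in> infinite_paths E. map x [0..<length \<beta>] = \<beta>}"
    by (intro Collect_cong conj_cong refl initial_segment_path_iff)
  finally show ?thesis .
qed

lemma awalk_infinite_path:
  assumes "wf_digraph E" "x \<in> infinite_paths E"
  shows "pre_digraph.awalk E (tail E (x 0)) (map x [0..<n]) (tail E (x n))"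
  using assms(2)
proof (induction n arbitrary: x)
  case 0
  then show ?case
    using assms(1) by (simp add: wf_digraph.awalk_simps infinite_paths_def wf_digraph.tail_in_verts)
next
  case (Suc n)
  have "pre_digraph.awalk E (tail E (x 1)) (map (\<lambda>i. x (Suc i)) [0..<n]) (tail E (x (Suc n)))"
    using Suc.IH[OF infinite_paths_suffix[OF Suc.prems, of 1]] by simp
  moreover have "x 0 \<in> arcs E" "tail E (x 1) = head E (x 0)"
    using Suc.prems by (auto simp: infinite_paths_def)
  ultimately show ?case
    using assms(1) by (simp add: map_upt_Suc wf_digraph.awalk_simps del: upt_Suc)
qed

lemma prefix_in_finite_paths:
  assumes "wf_digraph E" "x \<in> infinite_paths E"
  shows "map x [0..<Suc n] \<in> finite_paths E"
proof -
  have "map x [0..<Suc n] \<noteq> []"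
    by simp
  with awalk_infinite_path[OF assms, of "Suc n"] show ?thesis
    unfolding finite_paths_def by blast
qed

lemma topspace_path_space:
  assumes "wf_digraph E"
  shows "topspace (path_space E) = infinite_paths E"
proof -
  have "x \<in> cylinder E (map x [0..<Suc 0])" if "x \<in> infinite_paths E" for x
    using that by (simp add: cylinder_eq)
  then have "infinite_paths E \<subseteq> \<Union>(cylinder E ` finite_paths E)"
    using prefix_in_finite_paths[OF assms] by blast
  moreover have "\<Union>(cylinder E ` finite_paths E) \<subseteq> infinite_paths E"
    by (auto simp: cylinder_def)
  ultimately show ?thesis
    unfolding path_space_def topology_generated_by_topspace by blast
qed

lemma shift_in_path_space:
  assumes "wf_digraph E"
  shows "shift \<in> topspace (path_space E) \<rightarrow> topspace (path_space E)"
proof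
  fix x assume "x \<in> topspace (path_space E)"
  then have "(\<lambda>n. x (n + 1)) \<in> infinite_paths E"
    unfolding topspace_path_space[OF assms] by (rule infinite_paths_suffix)
  then show "shift x \<in> topspace (path_space E)"
    by (simp add: topspace_path_space[OF assms] shift_def)
qed

lemma openin_cylinder: "\<beta> \<in> finite_paths E \<Longrightarrow> openin (path_space E) (cylinder E \<beta>)"
  unfolding path_space_def by (intro topology_generated_by_Basis) simp

text \<open>By definition the cylinders merely generate the topology. Induction over the generation
  of open sets shows that they form a base; for an intersection the longer of the two prefixes
  serves.\<close>

lemma openin_path_space_cylinder:
  assumes "openin (path_space E) U" "x \<in> U"
  shows "\<exists>n. \<forall>y\<in>infinite_paths E. (\<forall>i\<le>n. y i = x i) \<longrightarrow> y \<in> U"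
proof -
  have "generate_topology_on (cylinder E ` finite_paths E) U"
    using assms(1) unfolding path_space_def by (rule openin_topology_generated_by)
  then show ?thesis
    using assms(2)
  proof induction
    case (Int a b)
    then obtain m n where "\<forall>y\<in>infinite_paths E. (\<forall>i\<le>m. y i = x i) \<longrightarrow> y \<in> a"
      "\<forall>y\<in>infinite_paths E. (\<forall>i\<le>n. y i = x i) \<longrightarrow> y \<in> b"
      by auto
    then show ?case
      by (intro exI[of _ "max m n"]) auto
  next
    case (UN K)
    then show ?case by (meson Union_iff)
  next
    case (Basis s)
    then obtain \<beta> where \<beta>: "s = cylinder E \<beta>"
      by auto
    show ?case
    proof (intro exI[of _ "length \<beta>"] ballI impI)
      fix y assume y: "y \<in> infinite_paths E" "\<forall>i\<le>length \<beta>. y i = x i"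
      then have "map y [0..<length \<beta>] = map x [0..<length \<beta>]"
        by simp
      with y Basis.prems show "y \<in> s"
        by (simp add: \<beta> cylinder_eq)
    qed
  qed simp
qed

text \<open>These paths form a closed subset of the power \<open>B^N\<close> of a finite discrete
  space, which is compact by Tychonoff. The identity into the path space is continuous because a
  cylinder restricts finitely many coordinates.\<close>

lemma compactin_paths_in_finite_subgraph:
  assumes "wf_digraph E" "finite B"
  shows "compactin (path_space E) {x \<in> infinite_paths E. range x \<subseteq> B}"
proof -
  define P where "P = product_topology (\<lambda>_::nat. discrete_topology B) UNIV"
  define C where "C = {x \<in> infinite_paths E. range x \<subseteq> B}"
  have P: "topspace P = {x. range x \<subseteq> B}"
    by (auto simp: P_def PiE_UNIV_domain)
  have proj: "continuous_map P (discrete_topology B) (\<lambda>x. x n)" for n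
    unfolding P_def by (intro continuous_map_product_projection) simp
  have "compact_space P"
    unfolding P_def using assms(2)
    by (simp add: compact_space_product_topology compact_space_discrete_topology)
  moreover have "closedin P C"
  proof -
    \<comment> \<open>The set of paths is an intersection of conditions on two consecutive edges,
      each closed as the preimage of a subset of a discrete space.\<close>
    define R where "R = {(a, b). a \<in> B \<and> b \<in> B \<and> a \<in> arcs E \<and> tail E b = head E a}"
    have R: "closedin (prod_topology (discrete_topology B) (discrete_topology B)) R"
      unfolding prod_topology_discrete_topology[symmetric] by (auto simp: R_def)
    have "closedin P {x \<in> topspace P. (x n, x (Suc n)) \<in> R}" for n
      by (rule closedin_continuous_map_preimage[OF _ R]) (intro continuous_map_pairedI proj)
    then have "closedin P (\<Inter>n. {x \<in> topspace P. (x n, x (Suc n)) \<in> R})"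
      by (intro closedin_INT) auto
    also have "(\<Inter>n. {x \<in> topspace P. (x n, x (Suc n)) \<in> R}) = C"
      unfolding P R_def C_def infinite_paths_def by auto
    finally show ?thesis .
  qed
  ultimately have "compactin P C"
    by (rule closedin_compact_space)
  then have "compactin (subtopology P C) C"
    by (simp add: compactin_subtopology)
  moreover have "continuous_map (subtopology P C) (path_space E) (\<lambda>x. x)"
    unfolding path_space_def
  proof (rule continuous_on_generated_topo)
    show "openin (subtopology P C) ((\<lambda>x. x) -` U \<inter> topspace (subtopology P C))"
      if "U \<in> cylinder E ` finite_paths E" for U
    proof -
      from that obtain \<beta> where \<beta>: "U = cylinder E \<beta>"
        by auto
      have "openin P {x \<in> topspace P. \<forall>k<n. x k = \<beta> ! k}" for n
      proof (induction n)
        case (Suc n)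
        \<comment> \<open>The edge \<open>\<beta> ! n\<close> may lie outside B, and the open sets
          of the discrete topology on B are the subsets of B.\<close>
        have "openin P {x \<in> topspace P. x n \<in> B \<inter> {\<beta> ! n}}"
          by (rule openin_continuous_map_preimage[OF proj]) simp
        then have "openin P ({x \<in> topspace P. \<forall>k<n. x k = \<beta> ! k} \<inter> {x \<in> topspace P. x n \<in> B \<inter> {\<beta> ! n}})"
          by (rule openin_Int[OF Suc])
        also have "\<dots> = {x \<in> topspace P. \<forall>k<Suc n. x k = \<beta> ! k}"
          by (auto simp: P less_Suc_eq)
        finally show ?case .
      qed simp
      moreover have "(\<lambda>x. x) -` U \<inter> topspace (subtopology P C) =
          C \<inter> {x \<in> topspace P. \<forall>k<length \<beta>. x k = \<beta> ! k}"
        unfolding \<beta> cylinder_eq C_def P map_upt_eq_iff topspace_subtopology by blast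
      ultimately show ?thesis
        by (simp only: openin_subtopology_Int2)
    qed
    show "(\<lambda>x. x) ` topspace (subtopology P C) \<subseteq> \<Union>(cylinder E ` finite_paths E)"
      unfolding topspace_path_space[OF assms(1), unfolded path_space_def topology_generated_by_topspace]
      by (auto simp: C_def)
  qed
  ultimately show ?thesis
    using image_compactin[of "subtopology P C" C "path_space E" "\<lambda>x. x"] by (simp add: C_def)
qed

section \<open>Closed paths and topological entropy\<close>

text \<open>Cover by first edges: paths in a common member of the n-th join have the same first n +
  1 edges, so each member of a subcover accounts for at most one prefix. Invariance makes every
  staying set equal to K.\<close>

lemma card_prefixes_le_min_subcover:
  fixes E :: "('v, 'e) pre_digraph"
  defines "\<alpha> \<equiv> (\<lambda>e. cylinder E [e]) ` arcs E"
  assumes wf: "wf_digraph E" and cpt: "compactin (path_space E) K" and ne: "K \<noteq> {}"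
    and inv: "\<And>x k. x \<in> K \<Longrightarrow> (\<lambda>n. x (n + k)) \<in> K"
  shows "open_cover_of (path_space E) K \<alpha>"
    and "finite ((\<lambda>x. map x [0..<Suc n]) ` K)"
    and "card ((\<lambda>x. map x [0..<Suc n]) ` K) \<le>
      min_subcover (iterated_join (path_space E) shift \<alpha> n) (staying_set (path_space E) shift K n)"
proof -
  note top = topspace_path_space[OF wf]
  have K: "K \<subseteq> infinite_paths E"
    using compactin_subset_topspace[OF cpt] top by simp
  have "[e] \<in> finite_paths E" if "e \<in> arcs E" for e
  proof -
    have "pre_digraph.awalk E (tail E e) [e] (head E e)"
      using that wf by (simp add: wf_digraph.awalk_simps wf_digraph.head_in_verts)
    then show ?thesis
      unfolding finite_paths_def by blast
  qed
  then have op: "openin (path_space E) U" if "U \<in> \<alpha>" for U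
    using that unfolding \<alpha>_def by (auto intro: openin_cylinder)
  have "x \<in> \<Union>\<alpha>" if "x \<in> K" for x
    using that K by (auto simp: \<alpha>_def cylinder_eq infinite_paths_def)
  with op show cover: "open_cover_of (path_space E) K \<alpha>"
    unfolding open_cover_of_def by blast
  have stay: "staying_set (path_space E) shift K n = K"
    using K inv[of _ 0] inv by (auto simp: staying_set_eq top shift_funpow dest: spec[of _ 0])
  from finite_subcover_iterated_join[OF cpt cover, of shift n] obtain \<beta>
    where "\<beta> \<subseteq> iterated_join (path_space E) shift \<alpha> n" "finite \<beta>" "K \<subseteq> \<Union>\<beta>"
    unfolding stay .
  from min_subcover_attained[OF this ne] obtain \<gamma> where
    \<gamma>: "\<gamma> \<subseteq> iterated_join (path_space E) shift \<alpha> n" "finite \<gamma>" "K \<subseteq> \<Union>\<gamma>"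
      "card \<gamma> = min_subcover (iterated_join (path_space E) shift \<alpha> n) K" .
  have same: "map x [0..<Suc n] = map y [0..<Suc n]" if U: "U \<in> \<gamma>" "x \<in> U" "y \<in> U" for x y U
  proof -
    have "\<Union>\<alpha> \<subseteq> topspace (path_space E)"
      using op openin_subset by blast
    from iterated_join_eq[OF this, of shift n] \<gamma>(1) U(1)
    obtain g where g: "\<forall>i\<le>n. g i \<in> \<alpha>"
      and U_eq: "U = {x \<in> topspace (path_space E). \<forall>i\<le>n. (shift ^^ i) x \<in> g i}"
      by auto
    have "x i = y i" if "i \<le> n" for i
    proof -
      have "(\<lambda>n. x (n + i)) \<in> g i" "(\<lambda>n. y (n + i)) \<in> g i" "g i \<in> \<alpha>"
        using U(2,3) g that unfolding U_eq by (auto simp: shift_funpow)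
      then show ?thesis
        by (auto simp: \<alpha>_def cylinder_eq)
    qed
    then show ?thesis
      by simp
  qed
  \<comment> \<open>Any representative of U will do, as all points of a member of the subcover share
    their prefix.\<close>
  define w where "w U = map (SOME x. x \<in> U) [0..<Suc n]" for U :: "'e word set"
  have "map x [0..<Suc n] \<in> w ` \<gamma>" if x: "x \<in> K" for x
  proof -
    obtain U where U: "U \<in> \<gamma>" "x \<in> U"
      using \<gamma>(3) x by blast
    have "map x [0..<Suc n] = w U"
      unfolding w_def by (rule same[OF U someI[of "\<lambda>x. x \<in> U", OF U(2)]])
    then show ?thesis
      using U(1) by (rule image_eqI)
  qed
  then have sub: "(\<lambda>x. map x [0..<Suc n]) ` K \<subseteq> w ` \<gamma>"
    by blast
  with \<gamma>(2) show "finite ((\<lambda>x. map x [0..<Suc n]) ` K)"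
    by (meson finite_imageI finite_subset)
  show "card ((\<lambda>x. map x [0..<Suc n]) ` K) \<le>
      min_subcover (iterated_join (path_space E) shift \<alpha> n) (staying_set (path_space E) shift K n)"
    unfolding stay \<gamma>(4)[symmetric] using surj_card_le[OF \<gamma>(2) sub] .
qed

text \<open>Closed paths through a common edge can be concatenated freely, within a finite subgraph.\<close>

lemma card_closed_paths_le:
  assumes wf: "wf_digraph E" and h: "top_entropy (path_space E) shift \<le> ereal h"
    and T: "finite T" "T \<subseteq> infinite_paths E" "\<And>x. x \<in> T \<Longrightarrow> x 0 = e \<and> x m = e"
    and inj: "inj_on (\<lambda>x. map x [0..<m]) T" and m: "m \<ge> 1"
  shows "card T \<le> exp (h * m)"
proof (cases "T = {}")
  case False
  then obtain t where t: "t \<in> T"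
    by blast
  define B where "B = (\<Union>x\<in>T. x ` {..<m})"
  define K where "K = {x \<in> infinite_paths E. range x \<subseteq> B}"
  \<comment> \<open>Block number q of the glued path consists of the first m edges of
    \<open>c q\<close>.\<close>
  define glue where "glue c n = c (n div m) (n mod m)" for c :: "nat \<Rightarrow> nat \<Rightarrow> 'b" and n
  have "finite B"
    unfolding B_def using T by auto
  then have cpt: "compactin (path_space E) K"
    unfolding K_def by (rule compactin_paths_in_finite_subgraph[OF wf])
  have glue: "glue c \<in> K" if c: "\<And>q. c q \<in> T" for c
  proof -
    have cX: "c q \<in> infinite_paths E" for q
      using c T by blast
    have "glue c n \<in> arcs E \<and> tail E (glue c (Suc n)) = head E (glue c n)" for n
    proof -
      have 1: "c q n \<in> arcs E" "tail E (c q (Suc n)) = head E (c q n)" for q n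
        using cX[of q] by (auto simp: infinite_paths_def)
      \<comment> \<open>At the end of a block the next edge is the first edge of the next block,
        which is \<open>e\<close>, and this is also edge number m of the current path. So the
        successor may be read off within the same path.\<close>
      have "glue c (Suc n) = c (n div m) (Suc (n mod m))"
      proof (cases "Suc (n mod m) = m")
        case True
        then have "Suc n mod m = 0"
          by (simp add: mod_Suc)
        then show ?thesis
          using True T(3)[OF c] by (simp add: glue_def)
      qed (simp add: glue_def div_Suc mod_Suc)
      then show ?thesis
        using 1 by (simp add: glue_def)
    qed
    moreover have "glue c n \<in> B" for n
      unfolding B_def glue_def using c m by (intro UN_I[of "c (n div m)"]) auto
    ultimately show ?thesis
      by (auto simp: K_def infinite_paths_def)
  qed
  have ne: "K \<noteq> {}"
    using t glue[of "\<lambda>_. t"] by blast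
  have inv: "(\<lambda>n. x (n + k)) \<in> K" if "x \<in> K" for x k
    using that infinite_paths_suffix[of x E k] by (auto simp: K_def)
  define \<alpha> where "\<alpha> = (\<lambda>e. cylinder E [e]) ` arcs E"
  note words = card_prefixes_le_min_subcover[OF wf cpt ne inv, folded \<alpha>_def]
  have lower: "k * ln (card T) \<le> cover_log (path_space E) shift \<alpha> K (m * k)" if k: "k \<ge> 1" for k
  proof -
    have mk: "m * k = Suc (m * k - 1)"
      using m k by (simp add: Suc_leI)
    \<comment> \<open>The first k blocks are free; after them \<open>t\<close> is repeated forever,
      to obtain an infinite path in K.\<close>
    define ext where "ext c q = (if q < k then c q else t)" for c :: "nat \<Rightarrow> nat \<Rightarrow> 'b" and q
    define W where "W c = map (glue (ext c)) [0..<m * k]" for c :: "nat \<Rightarrow> nat \<Rightarrow> 'b"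
    have extT: "ext c q \<in> T" if "c \<in> PiE {..<k} (\<lambda>_. T)" for c q
      using that t by (auto simp: ext_def)
    have "inj_on W (PiE {..<k} (\<lambda>_. T))"
    proof (rule inj_onI)
      fix c c' assume c: "c \<in> PiE {..<k} (\<lambda>_. T)" "c' \<in> PiE {..<k} (\<lambda>_. T)" and eq: "W c = W c'"
      show "c = c'"
      proof (rule PiE_ext[OF c])
        fix q assume q: "q \<in> {..<k}"
        have "c q r = c' q r" if r: "r < m" for r
        proof -
          have "q * m + r < Suc q * m"
            using r by simp
          also have "\<dots> \<le> m * k"
            using q by (subst mult.commute) (intro mult_le_mono, auto)
          finally have lt: "q * m + r < m * k" .
          then have "glue (ext c) (q * m + r) = glue (ext c') (q * m + r)"
            using arg_cong[OF eq, of "\<lambda>l. l ! (q * m + r)"] by (simp add: W_def)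
          then show ?thesis
            using r q by (simp add: glue_def ext_def)
        qed
        then show "c q = c' q"
          using c q by (intro inj_onD[OF inj]) (auto simp: PiE_iff)
      qed
    qed
    then have "card T ^ k = card (W ` PiE {..<k} (\<lambda>_. T))"
      by (simp add: card_image card_PiE)
    also have "\<dots> \<le> card ((\<lambda>x. map x [0..<Suc (m * k - 1)]) ` K)"
    proof (rule card_mono[OF words(2)])
      show "W ` PiE {..<k} (\<lambda>_. T) \<subseteq> (\<lambda>x. map x [0..<Suc (m * k - 1)]) ` K"
        unfolding mk[symmetric] W_def using glue extT by blast
    qed
    also note words(3)
    finally have le: "card T ^ k \<le> min_subcover (iterated_join (path_space E) shift \<alpha> (m * k - 1))
        (staying_set (path_space E) shift K (m * k - 1))" .
    have pos: "card T > 0"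
      using False T by (simp add: card_gt_0_iff)
    have "k * ln (card T) = ln (real (card T ^ k))"
      using pos by (simp add: ln_realpow)
    also have "\<dots> \<le> cover_log (path_space E) shift \<alpha> K (m * k)"
      unfolding cover_log_def using pos le by (intro ln_mono) (auto simp del: of_nat_power)
    finally show ?thesis .
  qed
  obtain L where L: "(\<lambda>k. cover_log (path_space E) shift \<alpha> K k / k) \<longlonglongrightarrow> L"
    "cover_entropy (path_space E) shift \<alpha> K = ereal L"
    using cover_entropy_limit[OF shift_in_path_space[OF wf] cpt words(1)] by metis
  have "ln (card T) / m \<le> L"
  proof (rule LIMSEQ_le_const)
    \<comment> \<open>The lower bound is known at positive multiples of m only, which suffices
      because the limit exists.\<close>
    have "strict_mono (\<lambda>k. m * Suc k)"
      using m by (intro strict_monoI) simp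
    from LIMSEQ_subseq_LIMSEQ[OF L(1) this]
    show "(\<lambda>k. cover_log (path_space E) shift \<alpha> K (m * Suc k) / real (m * Suc k)) \<longlonglongrightarrow> L"
      by (simp add: comp_def)
    have "ln (card T) / m \<le> cover_log (path_space E) shift \<alpha> K (m * Suc k) / real (m * Suc k)" for k
    proof -
      have "ln (card T) / m = Suc k * ln (card T) / real (m * Suc k)"
        unfolding of_nat_mult mult.commute[of "real m"] by (simp del: of_nat_Suc)
      also have "\<dots> \<le> cover_log (path_space E) shift \<alpha> K (m * Suc k) / real (m * Suc k)"
        by (intro divide_right_mono lower) auto
      finally show ?thesis .
    qed
    then show "\<exists>N. \<forall>k\<ge>N. ln (card T) / m \<le> cover_log (path_space E) shift \<alpha> K (m * Suc k) / real (m * Suc k)"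
      by blast
  qed
  also have "ereal L \<le> ereal h"
  proof -
    have "ereal L \<le> top_entropy_on (path_space E) shift K"
      unfolding top_entropy_on_def L(2)[symmetric] using words(1) by (intro SUP_upper) simp
    also have "\<dots> \<le> top_entropy (path_space E) shift"
      unfolding top_entropy_def using cpt by (intro SUP_upper) simp
    finally show ?thesis
      using h by (rule order.trans)
  qed
  then have "L \<le> h"
    by simp
  finally have "ln (card T) \<le> h * m"
    using m by (simp add: field_simps)
  then have "exp (ln (card T)) \<le> exp (h * m)"
    by simp
  then show ?thesis
    using False T by (simp add: card_gt_0_iff)
qed simp

section \<open>Words over a finite set of edges\<close>

text \<open>Blanking the other edges instead of deleting them preserves the times of the visible
  ones, and for finite F it leaves finitely many words of each length even if the graph is
  infinite.\<close>

definition edge_trace :: "'e set \<Rightarrow> 'e word \<Rightarrow> nat \<Rightarrow> 'e option list" where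
  "edge_trace F x n = map (\<lambda>i. if x i \<in> F then Some (x i) else None) [0..<n]"

definition edge_traces :: "('v, 'e) pre_digraph \<Rightarrow> 'e set \<Rightarrow> nat \<Rightarrow> 'e option list set" where
  "edge_traces E F n = (\<lambda>x. edge_trace F x n) ` infinite_paths E"

text \<open>The edge at time n, the return to \<open>e\<close>, is required but not recorded, so
  that the next piece of the path can start with it.\<close>

definition closed_edge_traces :: "('v, 'e) pre_digraph \<Rightarrow> 'e set \<Rightarrow> 'e \<Rightarrow> nat \<Rightarrow> 'e option list set" where
  "closed_edge_traces E F e n = (\<lambda>x. edge_trace F x n) ` {x \<in> infinite_paths E. x 0 = e \<and> x n = e}"

lemma trace_eq_iff:
  "edge_trace F x n = edge_trace F y n \<longleftrightarrow> (\<forall>k<n. x k \<in> F \<or> y k \<in> F \<longrightarrow> x k = y k)"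
proof -
  have "edge_trace F x n = edge_trace F y n \<longleftrightarrow>
    (\<forall>k<n. (if x k \<in> F then Some (x k) else None) = (if y k \<in> F then Some (y k) else None))"
    by (auto simp: edge_trace_def)
  also have "\<dots> \<longleftrightarrow> (\<forall>k<n. x k \<in> F \<or> y k \<in> F \<longrightarrow> x k = y k)"
    by (intro all_cong) auto
  finally show ?thesis .
qed

lemma trace_0 [simp]: "edge_trace F x 0 = []"
  by (simp add: edge_trace_def)

lemma trace_Suc:
  "edge_trace F x (Suc n) = (if x 0 \<in> F then Some (x 0) else None) # edge_trace F (\<lambda>i. x (i + 1)) n"
  by (simp add: edge_trace_def map_upt_Suc del: upt_Suc)

lemma trace_add: "edge_trace F x (m + n) = edge_trace F x m @ edge_trace F (\<lambda>i. x (i + m)) n"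
proof -
  have "[m..<m + n] = map (\<lambda>i. i + m) [0..<n]"
    by (simp add: map_add_upt add.commute)
  then show ?thesis
    by (simp add: edge_trace_def upt_add_eq_append[of 0 m n])
qed

lemma trace_insert: "\<forall>k<n. x k \<noteq> e \<Longrightarrow> edge_trace (insert e F) x n = edge_trace F x n"
  by (auto simp: edge_trace_def)

lemma finite_traces:
  assumes "finite F"
  shows "finite (edge_traces E F n)"
proof (rule finite_subset)
  show "edge_traces E F n \<subseteq> {w. set w \<subseteq> insert None (Some ` F) \<and> length w = n}"
    by (auto simp: edge_traces_def edge_trace_def)
  show "finite {w. set w \<subseteq> insert None (Some ` F) \<and> length w = n}"
    using assms by (intro finite_lists_length_eq) simp
qed

lemma finite_closed_traces:
  assumes "finite F"
  shows "finite (closed_edge_traces E F e n)"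
proof (rule finite_subset)
  show "closed_edge_traces E F e n \<subseteq> edge_traces E F n"
    unfolding closed_edge_traces_def edge_traces_def by (intro image_mono) simp
qed (rule finite_traces[OF assms])

text \<open>Choose one path for each trace. Paths with different traces have different prefixes, so
  the bound on closed paths applies to the chosen ones, even if infinitely many closed paths share a
  trace.\<close>

lemma card_closed_traces_le:
  assumes wf: "wf_digraph E" and h: "top_entropy (path_space E) shift \<le> ereal h" and F: "finite F"
  shows "card (closed_edge_traces E F e n) \<le> exp (h * n)"
proof (cases "n = 0")
  \<comment> \<open>The bound on closed paths needs positive length; in length 0 there is only the
    empty word.\<close>
  case True
  then have "closed_edge_traces E F e n \<subseteq> {[]}"
    by (auto simp: closed_edge_traces_def)
  then have "card (closed_edge_traces E F e n) \<le> card {[] :: 'b option list}"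
    by (intro card_mono) auto
  then show ?thesis
    using True by simp
next
  case False
  have "closed_edge_traces E F e n \<subseteq> (\<lambda>x. edge_trace F x n) ` {x \<in> infinite_paths E. x 0 = e \<and> x n = e}"
    by (simp add: closed_edge_traces_def)
  from subset_image_inj[THEN iffD1, OF this]
  obtain T where T: "T \<subseteq> {x \<in> infinite_paths E. x 0 = e \<and> x n = e}"
    "inj_on (\<lambda>x. edge_trace F x n) T" "closed_edge_traces E F e n = (\<lambda>x. edge_trace F x n) ` T"
    by (elim exE conjE) (rule that)
  have "finite T"
    using finite_closed_traces[OF F, of E e n] unfolding T(3) finite_image_iff[OF T(2)] .
  moreover have "inj_on (\<lambda>x. map x [0..<n]) T"
  proof (rule inj_onI)
    fix x y assume xy: "x \<in> T" "y \<in> T" "map x [0..<n] = map y [0..<n]"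
    then have "edge_trace F x n = edge_trace F y n"
      by (simp add: trace_eq_iff)
    then show "x = y"
      using xy(1,2) by (rule inj_onD[OF T(2)])
  qed
  ultimately have "card T \<le> exp (h * n)"
    using False T(1) by (intro card_closed_paths_le[OF wf h, of T e]) auto
  then show ?thesis
    using T by (simp add: card_image)
qed

text \<open>Cut a path at its first and its last passage through \<open>e\<close>.\<close>

lemma traces_insert_subset:
  "edge_traces E (insert e F) n \<subseteq> edge_traces E F n \<union>
    (\<Union>i<n. \<Union>j\<in>{i..<n}. (\<lambda>(a, w, b). a @ w @ Some e # b) `
      (edge_traces E F i \<times> closed_edge_traces E (insert e F) e (j - i) \<times> edge_traces E F (n - Suc j)))"
proof
  fix w assume "w \<in> edge_traces E (insert e F) n"
  then obtain x where x: "x \<in> infinite_paths E" and w: "w = edge_trace (insert e F) x n"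
    by (auto simp: edge_traces_def)
  define S where "S = {k. k < n \<and> x k = e}"
  show "w \<in> edge_traces E F n \<union>
    (\<Union>i<n. \<Union>j\<in>{i..<n}. (\<lambda>(a, w, b). a @ w @ Some e # b) `
      (edge_traces E F i \<times> closed_edge_traces E (insert e F) e (j - i) \<times> edge_traces E F (n - Suc j)))"
  proof (cases "S = {}")
    case True
    then have "w = edge_trace F x n"
      unfolding w by (intro trace_insert) (auto simp: S_def)
    then show ?thesis
      using x by (auto simp: edge_traces_def)
  next
    case False
    have fin: "finite S"
      by (simp add: S_def)
    define i j where "i = Min S" and "j = Max S"
    have ij: "i \<le> j" "i < n" "j < n" "x i = e" "x j = e"
      using Min_in[OF fin False] Max_in[OF fin False] Min_le[OF fin Max_in[OF fin False]]
      by (auto simp: i_def j_def S_def)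
    have before: "x k \<noteq> e" if "k < i" for k
    proof
      assume "x k = e"
      then have "k \<in> S"
        using that ij(2) by (simp add: S_def)
      with Min_le[OF fin] that show False
        unfolding i_def by (meson leD)
    qed
    have after: "x k \<noteq> e" if "j < k" "k < n" for k
    proof
      assume "x k = e"
      then have "k \<in> S"
        using that(2) by (simp add: S_def)
      with Max_ge[OF fin] that(1) show False
        unfolding j_def by (meson leD)
    qed
    \<comment> \<open>The pieces are: before the first passage, from the first up to the last
      passage, the edge \<open>e\<close> at time j, and the rest. If i = j, the middle piece is the
      empty word.\<close>
    have n: "n = i + ((j - i) + Suc (n - Suc j))"
      using ij by simp
    have shift_j: "(\<lambda>k. x (k + (j - i) + i)) = (\<lambda>k. x (k + j))"
      using ij(1) by (simp add: add.assoc)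
    have "w = edge_trace (insert e F) x (i + ((j - i) + Suc (n - Suc j)))"
      unfolding w using n by (rule arg_cong)
    also have "\<dots> = edge_trace (insert e F) x i @ edge_trace (insert e F) (\<lambda>k. x (k + i)) (j - i) @
        Some e # edge_trace (insert e F) (\<lambda>k. x (k + Suc j)) (n - Suc j)"
      unfolding trace_add shift_j trace_Suc using ij(5) by simp
    also have "edge_trace (insert e F) x i = edge_trace F x i"
      using before by (intro trace_insert) auto
    also have "edge_trace (insert e F) (\<lambda>k. x (k + Suc j)) (n - Suc j) = edge_trace F (\<lambda>k. x (k + Suc j)) (n - Suc j)"
      using after by (intro trace_insert) auto
    finally have "w = (\<lambda>(a, w, b). a @ w @ Some e # b)
        (edge_trace F x i, edge_trace (insert e F) (\<lambda>k. x (k + i)) (j - i), edge_trace F (\<lambda>k. x (k + Suc j)) (n - Suc j))"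
      by simp
    moreover have "edge_trace F x i \<in> edge_traces E F i"
      unfolding edge_traces_def using x by (rule imageI)
    moreover have "edge_trace F (\<lambda>k. x (k + Suc j)) (n - Suc j) \<in> edge_traces E F (n - Suc j)"
      unfolding edge_traces_def using infinite_paths_suffix[OF x] by (rule imageI)
    moreover have "edge_trace (insert e F) (\<lambda>k. x (k + i)) (j - i) \<in> closed_edge_traces E (insert e F) e (j - i)"
      unfolding closed_edge_traces_def using infinite_paths_suffix[OF x, of i] ij by (intro imageI) simp
    ultimately have "w \<in> (\<lambda>(a, w, b). a @ w @ Some e # b) `
      (edge_traces E F i \<times> closed_edge_traces E (insert e F) e (j - i) \<times> edge_traces E F (n - Suc j))"
      by (auto intro!: image_eqI)
    then show ?thesis
      using ij by (intro UnI2 UN_I[of i] UN_I[of j]) auto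
  qed
qed

lemma card_traces_insert_le:
  assumes F: "finite F"
  shows "card (edge_traces E (insert e F) n) \<le> card (edge_traces E F n) +
    (\<Sum>i<n. \<Sum>j\<in>{i..<n}.
      card (edge_traces E F i) * (card (closed_edge_traces E (insert e F) e (j - i)) * card (edge_traces E F (n - Suc j))))"
proof -
  define P where "P i j = edge_traces E F i \<times> closed_edge_traces E (insert e F) e (j - i) \<times> edge_traces E F (n - Suc j)" for i j
  define c where "c = (\<lambda>(a, w, b). a @ w @ Some e # b)"
  have fin: "finite (P i j)" for i j
    unfolding P_def using F by (intro finite_cartesian_product finite_traces finite_closed_traces) auto
  have "card (edge_traces E (insert e F) n) \<le> card (edge_traces E F n \<union> (\<Union>i<n. \<Union>j\<in>{i..<n}. c ` P i j))"
    using traces_insert_subset[of E e F n, folded c_def P_def] fin finite_traces[OF F]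
    by (intro card_mono) auto
  also have "\<dots> \<le> card (edge_traces E F n) + card (\<Union>i<n. \<Union>j\<in>{i..<n}. c ` P i j)"
    by (rule card_Un_le)
  also have "card (\<Union>i<n. \<Union>j\<in>{i..<n}. c ` P i j) \<le> (\<Sum>i<n. card (\<Union>j\<in>{i..<n}. c ` P i j))"
    by (rule card_UN_le) simp
  also have "\<dots> \<le> (\<Sum>i<n. \<Sum>j\<in>{i..<n}. card (c ` P i j))"
    by (intro sum_mono card_UN_le) simp
  also have "\<dots> \<le> (\<Sum>i<n. \<Sum>j\<in>{i..<n}. card (P i j))"
    by (intro sum_mono card_image_le fin)
  finally show ?thesis
    by (simp add: P_def card_cartesian_product)
qed

text \<open>Induction on F by cutting at the new edge. The exponential factors of the pieces
  multiply to at most \<open>exp (h * n)\<close>, so that each new edge affects the polynomial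
  factor only.\<close>

lemma card_traces_le:
  assumes wf: "wf_digraph E" and h: "top_entropy (path_space E) shift \<le> ereal h" and h0: "h \<ge> 0"
    and F: "finite F"
  shows "\<exists>d. \<forall>n. real (card (edge_traces E F n)) \<le> (real n + 2) ^ d * exp (h * n)"
  using F
proof induction
  case empty
  have "card (edge_traces E {} n) \<le> 1" for n
  proof -
    have "edge_traces E {} n \<subseteq> {replicate n None}"
      by (auto simp: edge_traces_def edge_trace_def map_replicate_trivial)
    then have "card (edge_traces E {} n) \<le> card {replicate n (None :: 'b option)}"
      by (intro card_mono) auto
    then show ?thesis
      by simp
  qed
  note le = this
  show ?case
  proof (intro exI[of _ 0] allI)
    fix n
    have "real (card (edge_traces E {} n)) \<le> 1"
      using le[of n] by linarith
    also have "1 \<le> (real n + 2) ^ 0 * exp (h * real n)"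
      using h0 by simp
    finally show "real (card (edge_traces E {} n)) \<le> (real n + 2) ^ 0 * exp (h * real n)" .
  qed
next
  case (insert e F)
  then obtain d where d: "\<And>n. real (card (edge_traces E F n)) \<le> (real n + 2) ^ d * exp (h * n)"
    by blast
  show ?case
  \<comment> \<open>The two outer pieces contribute degree d each. At most n^2 cuts, and 1 for the
    paths that avoid \<open>e\<close>, give 1 + n^2 <= (n + 2)^2.\<close>
  proof (intro exI[of _ "2 * d + 2"] allI)
    fix n
    let ?q = "real n + 2"
    let ?c = "\<lambda>i j. card (edge_traces E F i) *
      (card (closed_edge_traces E (insert e F) e (j - i)) * card (edge_traces E F (n - Suc j)))"
    have summand: "real (?c i j) \<le> ?q ^ (2 * d) * exp (h * n)" if ij: "i \<le> j" "j < n" for i j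
    proof -
      have d': "real (card (edge_traces E F k)) \<le> ?q ^ d * exp (h * k)" if "k \<le> n" for k
        using that by (intro order.trans[OF d[of k]] mult_right_mono power_mono) auto
      have "real (?c i j) \<le> (?q ^ d * exp (h * i)) * (exp (h * (j - i)) * (?q ^ d * exp (h * (n - Suc j))))"
        unfolding of_nat_mult using ij insert.hyps
        by (intro mult_mono d' card_closed_traces_le[OF wf h]) auto
      also have "\<dots> = ?q ^ (2 * d) * exp (h * i + h * (j - i) + h * (n - Suc j))"
        unfolding exp_add mult_2 power_add by (simp only: mult_ac)
      also have "h * i + h * (j - i) + h * (n - Suc j) = h * (i + (j - i) + (n - Suc j))"
        by (simp only: distrib_left of_nat_add)
      \<comment> \<open>The passage through \<open>e\<close> at time j belongs to none of the three
        pieces.\<close>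
      also have "i + (j - i) + (n - Suc j) = n - 1"
        using ij by simp
      also have "?q ^ (2 * d) * exp (h * real (n - 1)) \<le> ?q ^ (2 * d) * exp (h * n)"
        using h0 by (intro mult_left_mono) (auto intro: mult_left_mono)
      finally show ?thesis .
    qed
    have "real (card (edge_traces E (insert e F) n)) \<le>
        real (card (edge_traces E F n) + (\<Sum>i<n. \<Sum>j\<in>{i..<n}. ?c i j))"
      using card_traces_insert_le[OF insert.hyps(1), of E e n] by (simp only: of_nat_le_iff)
    also have "\<dots> = card (edge_traces E F n) + (\<Sum>i<n. \<Sum>j\<in>{i..<n}. real (?c i j))"
      by simp
    also have "\<dots> \<le> ?q ^ (2 * d) * exp (h * n) + (\<Sum>i<n. \<Sum>j<n. ?q ^ (2 * d) * exp (h * n))"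
    proof (intro add_mono sum_mono)
      show "real (card (edge_traces E F n)) \<le> ?q ^ (2 * d) * exp (h * n)"
        by (intro order.trans[OF d[of n]] mult_right_mono power_increasing) auto
      fix i
      have "(\<Sum>j\<in>{i..<n}. real (?c i j)) \<le> (\<Sum>j\<in>{i..<n}. ?q ^ (2 * d) * exp (h * n))"
        by (intro sum_mono summand) auto
      also have "\<dots> \<le> (\<Sum>j<n. ?q ^ (2 * d) * exp (h * n))"
        by (intro sum_mono2) auto
      finally show "(\<Sum>j\<in>{i..<n}. real (?c i j)) \<le> (\<Sum>j<n. ?q ^ (2 * d) * exp (h * n))" .
    qed
    also have "\<dots> = (1 + real n * real n) * (?q ^ (2 * d) * exp (h * n))"
      by (simp add: algebra_simps)
    also have "\<dots> \<le> ?q ^ 2 * (?q ^ (2 * d) * exp (h * n))"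
      by (intro mult_right_mono) (auto simp: power2_eq_square algebra_simps)
    also have "\<dots> = ?q ^ (2 * d + 2) * exp (h * n)"
      unfolding power_add by (simp only: mult_ac)
    finally show "real (card (edge_traces E (insert e F) n)) \<le> ?q ^ (2 * d + 2) * exp (h * n)" .
  qed
qed

section \<open>The path metric\<close>

lemma path_dist_commute: "path_dist E p x y = path_dist E p y x"
proof -
  have Least_eq: "(LEAST i. i \<ge> 1 \<and> initial_segment E (p i) x \<noteq> initial_segment E (p i) y) =
      (LEAST i. i \<ge> 1 \<and> initial_segment E (p i) y \<noteq> initial_segment E (p i) x)"
    by (rule arg_cong[where f = Least], intro ext conj_cong refl neq_commute)
  show ?thesis
    unfolding path_dist_def Least_eq eq_commute[of x y] ..
qed

text \<open>A separating index up to N would force the distance to be at least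
  \<open>(1 / 2) ^ N\<close>. The inequality is strict because the index N itself gives exactly this
  value.\<close>

lemma initial_segment_eq_of_path_dist:
  assumes "path_dist E p x y < (1 / 2) ^ N" "1 \<le> i" "i \<le> N"
  shows "initial_segment E (p i) x \<longleftrightarrow> initial_segment E (p i) y"
proof (rule ccontr)
  assume neq: "\<not> ?thesis"
  define l where "l = (LEAST i. i \<ge> 1 \<and> initial_segment E (p i) x \<noteq> initial_segment E (p i) y)"
  have "l \<le> N"
    unfolding l_def using neq assms by (intro order.trans[OF Least_le]) auto
  then have "(1 / 2 :: real) ^ N \<le> (1 / 2) ^ l"
    by (intro power_decreasing) auto
  moreover have "path_dist E p x y = (1 / 2) ^ l"
    using neq unfolding path_dist_def l_def by auto
  ultimately show False
    using assms by simp
qed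

lemma enumerates_segmentsE:
  assumes "enumerates_segments E p" "\<beta> \<in> segments E"
  obtains i where "i \<ge> 1" "p i = \<beta>"
proof -
  have "\<beta> \<in> p ` {1..}"
    using assms unfolding enumerates_segments_def by blast
  then show thesis
    using that by auto
qed

lemma path_segment_in_segments:
  assumes "wf_digraph E" "x \<in> infinite_paths E"
  shows "Path_segment (map x [0..<Suc n]) \<in> segments E"
  unfolding segments_def using prefix_in_finite_paths[OF assms] by blast

definition agree_upto ::
  "('v, 'e) pre_digraph \<Rightarrow> (nat \<Rightarrow> ('v, 'e) segment) \<Rightarrow> nat \<Rightarrow> 'e word \<Rightarrow> 'e word \<Rightarrow> bool" where
  "agree_upto E p N x y \<longleftrightarrow>
    (\<forall>i. 1 \<le> i \<longrightarrow> i \<le> N \<longrightarrow> (initial_segment E (p i) x \<longleftrightarrow> initial_segment E (p i) y))"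

text \<open>If x and y differ at index k, the prefix of x through k is a segment that tells them
  apart, so the \<open>LEAST\<close> in the metric is a genuine index. By agreement it is not among
  the first N.\<close>

lemma path_dist_le:
  assumes wf: "wf_digraph E" and p: "enumerates_segments E p"
    and xy: "x \<in> infinite_paths E" "y \<in> infinite_paths E"
    and agree: "agree_upto E p N x y"
  shows "path_dist E p x y \<le> (1 / 2) ^ N"
proof (cases "x = y")
  case False
  then obtain k where k: "x k \<noteq> y k"
    by blast
  obtain i where i: "i \<ge> 1" "p i = Path_segment (map x [0..<Suc k])"
    using enumerates_segmentsE[OF p path_segment_in_segments[OF wf xy(1)]] .
  have "initial_segment E (p i) x" "\<not> initial_segment E (p i) y"
    unfolding i(2) initial_segment_path_iff[OF xy(1)] initial_segment_path_iff[OF xy(2)]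
    using k by (simp_all add: eq_commute[of "y k"])
  with i(1) have ex: "i \<ge> 1 \<and> initial_segment E (p i) x \<noteq> initial_segment E (p i) y"
    by blast
  define l where "l = (LEAST i. i \<ge> 1 \<and> initial_segment E (p i) x \<noteq> initial_segment E (p i) y)"
  have "l \<ge> 1 \<and> initial_segment E (p l) x \<noteq> initial_segment E (p l) y"
    using LeastI[of "\<lambda>i. i \<ge> 1 \<and> initial_segment E (p i) x \<noteq> initial_segment E (p i) y", OF ex]
    unfolding l_def .
  then have "N \<le> l"
    using agree unfolding agree_upto_def by (meson nat_le_linear)
  then have "(1 / 2 :: real) ^ l \<le> (1 / 2) ^ N"
    by (intro power_decreasing) auto
  then show ?thesis
    using False by (simp add: path_dist_def l_def)
qed (simp add: path_dist_def)

lemma trace_eq_mono: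
  assumes "edge_trace F x l = edge_trace F y l" "F' \<subseteq> F" "l' \<le> l"
  shows "edge_trace F' x l' = edge_trace F' y l'"
  unfolding trace_eq_iff
proof (intro allI impI)
  fix k assume "k < l'" "x k \<in> F' \<or> y k \<in> F'"
  then have "k < l" "x k \<in> F \<or> y k \<in> F"
    using assms(2,3) by auto
  then show "x k = y k"
    using assms(1) unfolding trace_eq_iff by blast
qed

text \<open>Row-finiteness is used for the vertices: the source of a path lies in \<open>A\<close> if and only if its
  first edge is one of the finitely many edges leaving \<open>A\<close>.\<close>

lemma segment_determined_by_trace:
  assumes rf: "row_finite E" and \<beta>: "\<beta> \<in> segments E"
  shows "\<exists>F l. finite F \<and> (\<forall>x\<in>infinite_paths E. \<forall>y\<in>infinite_paths E.
    edge_trace F x l = edge_trace F y l \<longrightarrow> (initial_segment E \<beta> x \<longleftrightarrow> initial_segment E \<beta> y))"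
proof (cases \<beta>)
  case (Path_segment b)
  show ?thesis
  proof (intro exI conjI ballI impI)
    show "finite (set b)"
      by simp
    fix x y assume xy: "x \<in> infinite_paths E" "y \<in> infinite_paths E"
      and eq: "edge_trace (set b) x (length b) = edge_trace (set b) y (length b)"
    have "x k = b ! k \<longleftrightarrow> y k = b ! k" if "k < length b" for k
      using eq that nth_mem[OF that] unfolding trace_eq_iff by metis
    then show "initial_segment E \<beta> x \<longleftrightarrow> initial_segment E \<beta> y"
      unfolding Path_segment initial_segment_path_iff[OF xy(1)] initial_segment_path_iff[OF xy(2)]
        map_upt_eq_iff by blast
  qed
next
  case (Vertex_segment A)
  have A: "finite A" "A \<subseteq> verts E"
    using \<beta> by (auto simp: segments_def Vertex_segment)
  define F where "F = (\<Union>v\<in>A. out_arcs E v)"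
  have F: "z 0 \<in> F \<longleftrightarrow> tail E (z 0) \<in> A" if "z \<in> infinite_paths E" for z
  proof -
    have "z 0 \<in> arcs E"
      using that unfolding infinite_paths_def by blast
    then show ?thesis
      by (simp add: F_def out_arcs_def)
  qed
  show ?thesis
  proof (intro exI conjI ballI impI)
    show "finite F"
      unfolding F_def using A rf unfolding row_finite_def by (intro finite_UN_I) auto
    fix x y assume xy: "x \<in> infinite_paths E" "y \<in> infinite_paths E"
      and eq: "edge_trace F x 1 = edge_trace F y 1"
    have "x 0 \<in> F \<longleftrightarrow> y 0 \<in> F"
      using eq unfolding trace_eq_iff by (metis zero_less_one)
    then show "initial_segment E \<beta> x \<longleftrightarrow> initial_segment E \<beta> y"
      unfolding Vertex_segment initial_segment.simps F[OF xy(1)] F[OF xy(2)] .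
  qed
qed

text \<open>Finitely many segments are tested, so the union of their edge sets and the maximum of
  their lengths suffice.\<close>

lemma agree_upto_determined_by_trace:
  assumes rf: "row_finite E" and p: "p ` {1..} \<subseteq> segments E"
  shows "\<exists>F l. finite F \<and> (\<forall>x\<in>infinite_paths E. \<forall>y\<in>infinite_paths E.
    edge_trace F x l = edge_trace F y l \<longrightarrow> agree_upto E p N x y)"
proof (induction N)
  case 0
  have "agree_upto E p 0 x y" for x y
    by (simp add: agree_upto_def)
  then show ?case
    by (intro exI[of _ "{}"]) simp
next
  case (Suc N)
  then obtain F l where F: "finite F" "\<forall>x\<in>infinite_paths E. \<forall>y\<in>infinite_paths E.
      edge_trace F x l = edge_trace F y l \<longrightarrow> agree_upto E p N x y"
    by blast
  have "p (Suc N) \<in> segments E"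
    using p by auto
  from segment_determined_by_trace[OF rf this]
  obtain F' l' where F': "finite F'" "\<forall>x\<in>infinite_paths E. \<forall>y\<in>infinite_paths E.
      edge_trace F' x l' = edge_trace F' y l' \<longrightarrow>
        (initial_segment E (p (Suc N)) x \<longleftrightarrow> initial_segment E (p (Suc N)) y)"
    by blast
  show ?case
  proof (intro exI conjI ballI impI)
    show "finite (F \<union> F')"
      using F(1) F'(1) by simp
    fix x y assume xy: "x \<in> infinite_paths E" "y \<in> infinite_paths E"
      and eq: "edge_trace (F \<union> F') x (max l l') = edge_trace (F \<union> F') y (max l l')"
    have "edge_trace F x l = edge_trace F y l" "edge_trace F' x l' = edge_trace F' y l'"
      by (rule trace_eq_mono[OF eq]; simp)+
    then have "agree_upto E p N x y"
      "initial_segment E (p (Suc N)) x \<longleftrightarrow> initial_segment E (p (Suc N)) y"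
      using F(2) F'(2) xy by blast+
    then show "agree_upto E p (Suc N) x y"
      unfolding agree_upto_def by (metis le_Suc_eq)
  qed
qed

section \<open>Separated sets counted by traces\<close>

lemma bowen_dist_le_of_trace:
  assumes wf: "wf_digraph E" and rf: "row_finite E" and p: "enumerates_segments E p" and \<epsilon>: "\<epsilon> > 0"
  obtains F l where "finite F" "\<And>n x y. n \<ge> 1 \<Longrightarrow> x \<in> infinite_paths E \<Longrightarrow> y \<in> infinite_paths E \<Longrightarrow>
    edge_trace F x (n + l) = edge_trace F y (n + l) \<Longrightarrow> bowen_dist (path_dist E p) shift n x y \<le> \<epsilon>"
\<comment> \<open>Without infinite paths there may be no segments, and then \<open>p\<close> is
  arbitrary. With one, its prefixes are segments and \<open>p\<close> enumerates them all.\<close>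
proof (cases "infinite_paths E = {}")
  case True
  show thesis
    by (rule that[of "{}" 0]) (simp_all add: True)
next
  case False
  then have "segments E \<noteq> {}"
    using path_segment_in_segments[OF wf] by blast
  with p have ps: "p ` {1..} \<subseteq> segments E"
    by (simp add: enumerates_segments_def)
  obtain N where N: "(1 / 2 :: real) ^ N < \<epsilon>"
    using real_arch_pow_inv[OF \<epsilon>, of "1 / 2"] by auto
  from agree_upto_determined_by_trace[OF rf ps, of N]
  obtain F l where F: "finite F" "\<forall>x\<in>infinite_paths E. \<forall>y\<in>infinite_paths E.
      edge_trace F x l = edge_trace F y l \<longrightarrow> agree_upto E p N x y"
    by (elim exE conjE) (rule that)
  show thesis
  proof (rule that[OF F(1)])
    fix n x y assume n: "n \<ge> 1" and x: "x \<in> infinite_paths E" and y: "y \<in> infinite_paths E"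
      and eq: "edge_trace F x (n + l) = edge_trace F y (n + l)"
    \<comment> \<open>The iterates start at times below n and each is inspected over l edges, hence
      the window n + l. F and l depend on \<epsilon> but not on n.\<close>
    have "path_dist E p ((shift ^^ i) x) ((shift ^^ i) y) \<le> \<epsilon>" if i: "i < n" for i
    proof -
      have "edge_trace F (\<lambda>k. x (k + i)) l = edge_trace F (\<lambda>k. y (k + i)) l"
        unfolding trace_eq_iff
      proof (intro allI impI)
        fix k assume "k < l" and kF: "x (k + i) \<in> F \<or> y (k + i) \<in> F"
        then have "k + i < n + l"
          using i by linarith
        with kF show "x (k + i) = y (k + i)"
          using eq unfolding trace_eq_iff by blast
      qed
      then have "agree_upto E p N (\<lambda>k. x (k + i)) (\<lambda>k. y (k + i))"
        using F(2) infinite_paths_suffix[OF x] infinite_paths_suffix[OF y] by blast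
      then have "path_dist E p (\<lambda>k. x (k + i)) (\<lambda>k. y (k + i)) \<le> (1 / 2) ^ N"
        by (rule path_dist_le[OF wf p infinite_paths_suffix[OF x] infinite_paths_suffix[OF y]])
      then show ?thesis
        using N by (simp add: shift_funpow)
    qed
    moreover have "{..<n} \<noteq> {}"
      using n by (simp add: lessThan_empty_iff)
    ultimately show "bowen_dist (path_dist E p) shift n x y \<le> \<epsilon>"
      unfolding bowen_dist_def by (intro Max.boundedI) auto
  qed
qed

lemma sep_bound_path_dist:
  assumes wf: "wf_digraph E" and rf: "row_finite E" and p: "enumerates_segments E p" and \<epsilon>: "\<epsilon> > 0"
    and K: "K \<subseteq> infinite_paths E"
  obtains F l where "finite F"
    "\<And>n. n \<ge> 1 \<Longrightarrow> sep_bound (path_dist E p) shift K n \<epsilon> (card (edge_traces E F (n + l)))"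
proof -
  obtain F l where F: "finite F" "\<And>n x y. n \<ge> 1 \<Longrightarrow> x \<in> infinite_paths E \<Longrightarrow> y \<in> infinite_paths E \<Longrightarrow>
    edge_trace F x (n + l) = edge_trace F y (n + l) \<Longrightarrow> bowen_dist (path_dist E p) shift n x y \<le> \<epsilon>"
    using bowen_dist_le_of_trace[OF wf rf p \<epsilon>] by metis
  have "card A \<le> card (edge_traces E F (n + l))"
    if n: "n \<ge> 1" and A: "A \<subseteq> K" "separated (path_dist E p) shift n \<epsilon> A" for A n
  proof (rule card_inj_on_le)
    show "inj_on (\<lambda>x. edge_trace F x (n + l)) A"
    proof (rule inj_onI, rule ccontr)
      fix x y assume xy: "x \<in> A" "y \<in> A" "edge_trace F x (n + l) = edge_trace F y (n + l)" "x \<noteq> y"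
      with A(2) have "bowen_dist (path_dist E p) shift n x y > \<epsilon>"
        by (simp add: separated_def)
      moreover have "bowen_dist (path_dist E p) shift n x y \<le> \<epsilon>"
        using xy A(1) K by (intro F(2) n) auto
      ultimately show False
        by simp
    qed
    show "(\<lambda>x. edge_trace F x (n + l)) ` A \<subseteq> edge_traces E F (n + l)"
      using A(1) K by (auto simp: edge_traces_def)
    show "finite (edge_traces E F (n + l))"
      by (rule finite_traces[OF F(1)])
  qed
  with F(1) that show thesis
    unfolding sep_bound_def by blast
qed

text \<open>After taking logarithms and dividing by n, neither the polynomial factor nor the extra
  window length l survives in the limit.\<close>

lemma sep_growth_path_dist_le:
  assumes wf: "wf_digraph E" and rf: "row_finite E" and p: "enumerates_segments E p" and \<epsilon>: "\<epsilon> > 0"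
    and K: "K \<subseteq> infinite_paths E"
    and h: "top_entropy (path_space E) shift \<le> ereal h" and h0: "h \<ge> 0"
  shows "sep_growth (path_dist E p) shift K \<epsilon> \<le> ereal h"
proof -
  let ?s = "\<lambda>n. real (sep (path_dist E p) shift K n \<epsilon>)"
  obtain F l where F: "finite F"
    "\<And>n. n \<ge> 1 \<Longrightarrow> sep_bound (path_dist E p) shift K n \<epsilon> (card (edge_traces E F (n + l)))"
    using sep_bound_path_dist[OF wf rf p \<epsilon> K] by metis
  obtain d where d: "\<And>n. real (card (edge_traces E F n)) \<le> (real n + 2) ^ d * exp (h * n)"
    using card_traces_le[OF wf h h0 F(1)] by blast
  have le: "ln (?s n) \<le> d * ln (real n + real l + 2) + h * (real n + real l)" if n: "n \<ge> 1" for n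
  proof (cases "?s n = 0")
    case True
    then show ?thesis
      using h0 by simp
  next
    case False
    have "?s n \<le> real (card (edge_traces E F (n + l)))"
      using sep_le[OF F(2)[OF n]] by simp
    also note d[of "n + l"]
    finally have "ln (?s n) \<le> ln ((real (n + l) + 2) ^ d * exp (h * real (n + l)))"
      using False by (intro ln_mono) auto
    also have "\<dots> = d * ln (real n + real l + 2) + h * (real n + real l)"
      by (simp add: ln_mult_pos ln_realpow add_pos_nonneg)
    finally show ?thesis .
  qed
  have "sep_growth (path_dist E p) shift K \<epsilon> \<le>
      limsup (\<lambda>n. ereal (1 / real n * (d * ln (real n + real l + 2) + h * (real n + real l))))"
    unfolding sep_growth_def
  proof (intro Limsup_mono eventually_sequentiallyI[of 1])
    fix n :: nat assume n: "1 \<le> n"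
    show "ereal (1 / real n * ln (?s n)) \<le>
        ereal (1 / real n * (d * ln (real n + real l + 2) + h * (real n + real l)))"
      unfolding ereal_less_eq(3) by (intro mult_left_mono le[OF n]) auto
  qed
  also have "\<dots> = ereal h"
  proof (intro lim_imp_Limsup)
    have "(\<lambda>n. 1 / real n * (d * ln (real n + real l + 2) + h * (real n + real l))) \<longlonglongrightarrow> h"
      by real_asymp
    then show "(\<lambda>n. ereal (1 / real n * (d * ln (real n + real l + 2) + h * (real n + real l)))) \<longlonglongrightarrow> ereal h"
      by simp
  qed simp
  finally show ?thesis .
qed

text \<open>Each point of K has a prefix whose cylinder lies in a member of \<alpha>, and finitely
  many of these cylinders cover K. A point close enough to x agrees with x on all the segments
  involved, hence lies in the same cylinder.\<close>

lemma path_space_lebesgue_number: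
  assumes wf: "wf_digraph E" and p: "enumerates_segments E p"
    and cpt: "compactin (path_space E) K" and \<alpha>: "open_cover_of (path_space E) K \<alpha>"
  obtains \<epsilon> where "\<epsilon> > 0" "\<And>x. x \<in> K \<Longrightarrow> \<exists>U\<in>\<alpha>. x \<in> U \<and>
    (\<forall>y\<in>topspace (path_space E). path_dist E p y x \<le> \<epsilon> \<longrightarrow> y \<in> U)"
proof -
  have K: "K \<subseteq> infinite_paths E"
    using compactin_subset_topspace[OF cpt] topspace_path_space[OF wf] by simp
  define S where "S i = {y \<in> infinite_paths E. initial_segment E (p i) y}" for i
  define I where "I = {i. i \<ge> 1 \<and> openin (path_space E) (S i) \<and> (\<exists>U\<in>\<alpha>. S i \<subseteq> U)}"
  have "x \<in> \<Union>(S ` I)" if x: "x \<in> K" for x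
  proof -
    from x \<alpha> obtain U where U: "U \<in> \<alpha>" "x \<in> U" "openin (path_space E) U"
      unfolding open_cover_of_def by blast
    obtain n where n: "\<forall>y\<in>infinite_paths E. (\<forall>i\<le>n. y i = x i) \<longrightarrow> y \<in> U"
      using openin_path_space_cylinder[OF U(3,2)] by blast
    have xX: "x \<in> infinite_paths E"
      using x K by blast
    obtain i where i: "i \<ge> 1" "p i = Path_segment (map x [0..<Suc n])"
      using enumerates_segmentsE[OF p path_segment_in_segments[OF wf xX]] .
    have S: "S i = cylinder E (map x [0..<Suc n])"
      unfolding S_def i(2) cylinder_eq by (intro Collect_cong conj_cong refl initial_segment_path_iff)
    have "y \<in> U" if "y \<in> S i" for y
    proof -
      have y: "y \<in> infinite_paths E" "map y [0..<Suc n] = map x [0..<Suc n]"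
        using that unfolding S cylinder_eq by (simp_all del: upt_Suc)
      then have "\<forall>i\<le>n. y i = x i"
        by (simp add: less_Suc_eq_le del: upt_Suc)
      then show ?thesis
        using n y(1) by blast
    qed
    moreover have "openin (path_space E) (S i)"
      unfolding S by (rule openin_cylinder[OF prefix_in_finite_paths[OF wf xX]])
    ultimately have "i \<in> I"
      unfolding I_def using i(1) U(1) by blast
    moreover have "x \<in> S i"
      unfolding S cylinder_eq using xX by simp
    ultimately show ?thesis
      by blast
  qed
  moreover have "\<forall>V\<in>S ` I. openin (path_space E) V"
    by (simp add: I_def)
  ultimately have "\<exists>\<C>. finite \<C> \<and> \<C> \<subseteq> S ` I \<and> K \<subseteq> \<Union>\<C>"
    using cpt unfolding compactin_def by blast
  then obtain J where J: "J \<subseteq> I" "finite J" "K \<subseteq> \<Union>(S ` J)"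
    using finite_subset_image by metis
  \<comment> \<open>The sum serves as an upper bound of the indices in J that also makes sense for
    empty J. One more power of 1/2 below gives the strict inequality.\<close>
  define N where "N = (\<Sum>i\<in>J. i)"
  show thesis
  proof
    show "(1 / 2 :: real) ^ Suc N > 0"
      by simp
    fix x assume "x \<in> K"
    then obtain i where i: "i \<in> J" "x \<in> S i"
      using J(3) by blast
    then have "i \<ge> 1"
      using J(1) by (auto simp: I_def)
    obtain U where U: "U \<in> \<alpha>" "S i \<subseteq> U"
      using i(1) J(1) unfolding I_def by blast
    have "i \<le> N"
      unfolding N_def using i(1) J(2) by (intro member_le_sum) auto
    have "y \<in> S i" if y: "y \<in> infinite_paths E" "path_dist E p y x \<le> (1 / 2) ^ Suc N" for y
    proof -
      have "path_dist E p y x < (1 / 2) ^ N"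
        using y(2) by (rule order.strict_trans1) simp
      from initial_segment_eq_of_path_dist[OF this \<open>i \<ge> 1\<close> \<open>i \<le> N\<close>] show ?thesis
        using i(2) y(1) by (simp add: S_def)
    qed
    then show "\<exists>U\<in>\<alpha>. x \<in> U \<and>
        (\<forall>y\<in>topspace (path_space E). path_dist E p y x \<le> (1 / 2) ^ Suc N \<longrightarrow> y \<in> U)"
      unfolding topspace_path_space[OF wf] using U i(2) by blast
  qed
qed

section \<open>The two inequalities between the entropies\<close>

theorem corollary7p22:
  fixes E :: "('v, 'e) pre_digraph"
    and p :: "nat \<Rightarrow> ('v, 'e) segment"
  assumes "countable_graph E"
    and "locally_finite_graph E"
    and "no_sinks E"
    and "enumerates_segments E p"
  shows "metric_entropy (path_space E) (path_dist E p) shift = top_entropy (path_space E) shift"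
proof -
  have wf: "wf_digraph E" and rf: "row_finite E" and p: "enumerates_segments E p"
    using assms by (auto simp: countable_graph_def locally_finite_graph_def)
  let ?X = "path_space E" and ?d = "path_dist E p"
  have KX: "K \<subseteq> infinite_paths E" if "compactin ?X K" for K
    using compactin_subset_topspace[OF that] topspace_path_space[OF wf] by simp
  have bdd: "\<exists>M. sep_bound ?d shift K n \<epsilon> M" if "compactin ?X K" "n \<ge> 1" "\<epsilon> > 0" for K n \<epsilon>
    using sep_bound_path_dist[OF wf rf p that(3) KX[OF that(1)]] that(2) by metis
  have on: "metric_entropy_on ?d shift K = (SUP \<epsilon>\<in>{0<..}. sep_growth ?d shift K \<epsilon>)"
    if "compactin ?X K" for K
    using bdd[OF that] by (rule metric_entropy_on_eq_SUP)
  show ?thesis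
  proof (rule antisym)
    show "metric_entropy ?X ?d shift \<le> top_entropy ?X shift"
    \<comment> \<open>If the topological entropy is infinite there is nothing to prove; otherwise it
      is itself a real rate h for the trace bound.\<close>
    proof (cases "top_entropy ?X shift")
      case (real h)
      then have h: "top_entropy ?X shift \<le> ereal h" "h \<ge> 0"
        using top_entropy_nonneg[OF shift_in_path_space[OF wf]] by auto
      have "metric_entropy_on ?d shift K \<le> ereal h" if K: "compactin ?X K" for K
        unfolding on[OF K]
        using sep_growth_path_dist_le[OF wf rf p _ KX[OF K] h] by (intro SUP_least) simp
      then show ?thesis
        unfolding metric_entropy_def real by (intro SUP_least) simp
    qed (use top_entropy_nonneg[OF shift_in_path_space[OF wf]] in auto)
  next
    have "cover_entropy ?X shift \<alpha> K \<le> metric_entropy ?X ?d shift"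
      if K: "compactin ?X K" and \<alpha>: "open_cover_of ?X K \<alpha>" for K \<alpha>
    proof -
      obtain \<epsilon> where \<epsilon>: "\<epsilon> > 0" "\<And>x. x \<in> K \<Longrightarrow> \<exists>U\<in>\<alpha>. x \<in> U \<and>
          (\<forall>y\<in>topspace ?X. ?d y x \<le> \<epsilon> \<longrightarrow> y \<in> U)"
        using path_space_lebesgue_number[OF wf p K \<alpha>] by metis
      have "cover_entropy ?X shift \<alpha> K \<le> sep_growth ?d shift K \<epsilon>"
        by (rule cover_entropy_le_sep_growth[OF shift_in_path_space[OF wf] K \<alpha> _ path_dist_commute])
          (use bdd[OF K] \<epsilon> in auto)
      also have "\<dots> \<le> metric_entropy_on ?d shift K"
        unfolding on[OF K] using \<epsilon> by (intro SUP_upper) simp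
      also have "\<dots> \<le> metric_entropy ?X ?d shift"
        unfolding metric_entropy_def using K by (intro SUP_upper) simp
      finally show ?thesis .
    qed
    then show "top_entropy ?X shift \<le> metric_entropy ?X ?d shift"
      unfolding top_entropy_def top_entropy_on_def by (intro SUP_least) simp
  qed
qed

end
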